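(* Let $k\in\mathbb{R}$, let $v$ be a multiplier system of weight $k$ on $\mathrm{SL}(2,\mathbb{Z})$, let $R$ be an $n$-dimensional complex representation of $\mathrm{SL}(2,\mathbb{Z})$, and let $F=(f_1,\ldots,f_n)^{\mathrm{T}}\in\mathcal{M}^!(k,\mathrm{SL}(2,\mathbb{Z}),v,R)$. Suppose that each $f_i$ has a convergent $q$-expansion $f_i=q^{\lambda_i}\sum_{t=0}^{\infty}a_{it}q^{mt}$ with a common $m>0$ and $a_{i0}\neq 0$, and that $\lambda_1,\ldots,\lambda_n\in\mathbb{R}$ are pairwise distinct. Then: (1) $n(k+n-1)\ge 12(\lambda_1+\cdots+\lambda_n)$; (2) $f_1,\ldots,f_n$ are solutions to one MLDE of order $n$ and weight $k$; (3) the following are equivalent: (a) $n(k+n-1)=12(\lambda_1+\cdots+\lambda_n)$; (b) $f_1,\ldots,f_n$ are solutions to one monic MLDE of order $n$ and weight $k$.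
   Context: $\mathcal{H}$ is the upper half plane, $q=e^{2\pi i z}$, $q^{\alpha}=e^{2\pi i\alpha z}$, and $f'=\frac{1}{2\pi i}\frac{df}{dz}$. For $A=\begin{pmatrix}a&b\\c&d\end{pmatrix}\in\mathrm{SL}(2,\mathbb{Z})$ and a holomorphic $f$ on $\mathcal{H}$, $(f|_kA)(z)=(cz+d)^{-k}f(Az)$, powers computed with the principal argument in $(-\pi,\pi]$; for vectors the slash acts componentwise. A multiplier system of weight $k$ is the standard notion (a function $v$ on $\mathrm{SL}(2,\mathbb{Z})$ with $|v|=1$ compatible with the weight-$k$ slash action). $\mathcal{M}^!(k,\mathrm{SL}(2,\mathbb{Z}),v,R)$ is the set of $F\in\mathrm{Hol}(\mathcal{H})^n$ with $F|_kB=v(B)R(B)F$ for all $B\in\mathrm{SL}(2,\mathbb{Z})$ and such that for every $A\in\mathrm{SL}(2,\mathbb{Z})$ each component of $F|_kA$ has at most exponential growth at infinity (there exist $C,M>0$ with $|g(z)|<e^{C\,\mathrm{Im}(z)}$ for $\mathrm{Im}(z)>M$). $E_2,E_4,E_6$ are the Eisenstein series normalized to have constant term $1$; $\mathcal{M}_w$ denotes the space of holomorphic modular forms of weight $w$ on $\mathrm{SL}(2,\mathbb{Z})$ with trivial multiplier. For $k\in\mathbb{R}$, $D_kf=f'-\frac{k}{12}E_2f$, $D_k^{(0)}=\mathrm{id}$, $D_k^{(j)}=D_{k+2j-2}\circ\cdots\circ D_{k+2}\circ D_k$. An MLDE of weight $k$ and order $n$ is an equation $(g_0D_k^{(n)}+g_1D_k^{(n-1)}+\cdots+g_{n-1}D_k+g_n)f=0$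 with $g_i\in\mathcal{M}_{l+2i}$ for some integer $l\ge0$ and $g_0\neq0$; it is monic if $l=0$ and $g_0=1$. *)

theory Defs
  imports "HOL-Analysis.Analysis"
begin

definition UHP :: "complex set" where
  "UHP = {z. Im z > 0}"

definition SL2Z :: "(int^2^2) set" where
  "SL2Z = {A. det A = 1}"

definition moeb :: "int^2^2 \<Rightarrow> complex \<Rightarrow> complex" where
  "moeb A z = (of_int (A$1$1) * z + of_int (A$1$2)) / (of_int (A$2$1) * z + of_int (A$2$2))"

definition jfac :: "int^2^2 \<Rightarrow> complex \<Rightarrow> complex" where
  "jfac A z = of_int (A$2$1) * z + of_int (A$2$2)"

definition qpow :: "real \<Rightarrow> complex \<Rightarrow> complex" where
  "qpow \<alpha> z = exp (2 * of_real pi * \<i> * of_real \<alpha> * z)"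

text \<open>Weight-k slash action; complex powr uses the principal branch (Arg in (-pi,pi]).\<close>
definition slash :: "real \<Rightarrow> int^2^2 \<Rightarrow> (complex \<Rightarrow> complex) \<Rightarrow> complex \<Rightarrow> complex" where
  "slash k A f z = jfac A z powr (- of_real k) * f (moeb A z)"

definition vslash :: "real \<Rightarrow> int^2^2 \<Rightarrow> (complex \<Rightarrow> complex^'n) \<Rightarrow> complex \<Rightarrow> complex^'n" where
  "vslash k A F z = (\<chi> i. slash k A (\<lambda>w. F w $ i) z)"

text \<open>Multiplier system of weight k: |v| = 1 and the cocycle condition making it
  compatible with the weight-k slash action.\<close>
definition multiplier_system :: "real \<Rightarrow> (int^2^2 \<Rightarrow> complex) \<Rightarrow> bool" where
  "multiplier_system k v \<longleftrightarrow>
     (\<forall>A\<in>SL2Z. norm (v A) = 1) \<and>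
     (\<forall>A\<in>SL2Z. \<forall>B\<in>SL2Z. \<forall>z\<in>UHP.
        v (A ** B) * jfac (A ** B) z powr (of_real k)
        = v A * v B * jfac A (moeb B z) powr (of_real k) * jfac B z powr (of_real k))"

definition representation :: "(int^2^2 \<Rightarrow> complex^'n^'n) \<Rightarrow> bool" where
  "representation R \<longleftrightarrow>
     R (mat 1) = mat 1 \<and> (\<forall>A\<in>SL2Z. \<forall>B\<in>SL2Z. R (A ** B) = R A ** R B)"

definition exp_growth :: "(complex \<Rightarrow> complex) \<Rightarrow> bool" where
  "exp_growth g \<longleftrightarrow> (\<exists>C>0. \<exists>M>0. \<forall>z. Im z > M \<longrightarrow> norm (g z) < exp (C * Im z))"

definition weakly_hol_vvmf ::
  "real \<Rightarrow> (int^2^2 \<Rightarrow> complex) \<Rightarrow> (int^2^2 \<Rightarrow> complex^'n^'n) \<Rightarrow> (complex \<Rightarrow> complex^'n) \<Rightarrow> bool" where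
  "weakly_hol_vvmf k v R F \<longleftrightarrow>
     (\<forall>i. (\<lambda>z. F z $ i) holomorphic_on UHP) \<and>
     (\<forall>B\<in>SL2Z. \<forall>z\<in>UHP. vslash k B F z = v B *s (R B *v F z)) \<and>
     (\<forall>A\<in>SL2Z. \<forall>i. exp_growth (\<lambda>z. vslash k A F z $ i))"

definition modular_form :: "nat \<Rightarrow> (complex \<Rightarrow> complex) \<Rightarrow> bool" where
  "modular_form w f \<longleftrightarrow>
     f holomorphic_on UHP \<and>
     (\<forall>A\<in>SL2Z. \<forall>z\<in>UHP. f (moeb A z) = jfac A z ^ w * f z) \<and>
     (\<exists>c :: nat \<Rightarrow> complex. \<forall>z\<in>UHP. (\<lambda>t. c t * qpow (real t) z) sums f z)"

definition sigma1 :: "nat \<Rightarrow> nat" where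
  "sigma1 n = (\<Sum>d | d dvd n. d)"

definition E2 :: "complex \<Rightarrow> complex" where
  "E2 z = 1 - 24 * (\<Sum>n. of_nat (sigma1 (Suc n)) * qpow (real (Suc n)) z)"

definition Dop :: "real \<Rightarrow> (complex \<Rightarrow> complex) \<Rightarrow> complex \<Rightarrow> complex" where
  "Dop k f z = deriv f z / (2 * of_real pi * \<i>) - of_real k / 12 * E2 z * f z"

fun Diter :: "real \<Rightarrow> nat \<Rightarrow> (complex \<Rightarrow> complex) \<Rightarrow> complex \<Rightarrow> complex" where
  "Diter k 0 f = f"
| "Diter k (Suc j) f = Dop (k + 2 * real j) (Diter k j f)"

definition is_MLDE :: "nat \<Rightarrow> nat \<Rightarrow> (nat \<Rightarrow> complex \<Rightarrow> complex) \<Rightarrow> bool" where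
  "is_MLDE n l g \<longleftrightarrow> (\<forall>i\<le>n. modular_form (l + 2 * i) (g i)) \<and> (\<exists>z\<in>UHP. g 0 z \<noteq> 0)"

definition is_monic_MLDE :: "nat \<Rightarrow> (nat \<Rightarrow> complex \<Rightarrow> complex) \<Rightarrow> bool" where
  "is_monic_MLDE n g \<longleftrightarrow> is_MLDE n 0 g \<and> (\<forall>z\<in>UHP. g 0 z = 1)"

definition solves_MLDE :: "real \<Rightarrow> nat \<Rightarrow> (nat \<Rightarrow> complex \<Rightarrow> complex) \<Rightarrow> (complex \<Rightarrow> complex) \<Rightarrow> bool" where
  "solves_MLDE k n g f \<longleftrightarrow> (\<forall>z\<in>UHP. (\<Sum>i\<le>n. g i z * Diter k (n - i) f z) = 0)"

end

(* The Wronskian of f_1, ..., f_n, formed with the Serre derivatives D_k^(j), transforms under S and T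
   with weight n(k+n-1) up to constant factors, and its leading exponent at the cusp is the sum of the
   lambda_i, with a Vandermonde determinant as leading coefficient. Divide it by eta to twice its weight:
   since S^2 and (ST)^3 act trivially, the sixth power of the quotient is an invariant function. If its
   exponent at the cusp were positive, the maximum principle would force it to vanish, which gives (1).
   If the exponent is zero, the function is a nonzero constant, so the Wronskian has no zeros.
   Cramer's rule expresses D^n f_i through the lower derivatives with quotients of Wronskian minors as
   coefficients. Clearing denominators with powers of the Wronskian and of the discriminant gives (2),
   and in the zero-free case the quotients are themselves modular forms. Conversely, the lambda_i are
   the roots of the indicial polynomial of a monic equation. There is no contribution from g_1, as a
   form of weight 2 has constant term zero, so their sum is determined. *)
theory Submission
  imports Defs "HOL-Complex_Analysis.Complex_Analysis"
begin

section \<open>Transformation of the Eisenstein series of weight 2\<close>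

text \<open>The Serre derivative is covariant and eta has a transformation law for the same reason:
  the behaviour of \<open>E2\<close> under z -> -1/z. Since \<open>E2\<close> is given by its
  divisor-sum series, with no symmetry in sight, the proof returns to the lattice sum of 1/(m z +
  n)^2, which converges only conditionally; the correction term in the law for \<open>E2\<close>
  measures how far the two orders of summation disagree. The weight k is real, so real powers of eta
  occur. They are exponentials of an explicit logarithm \<open>ln_eta2\<close>, whose laws under
  translation and inversion are exact identities. The number n(k+n-1) has two sources that match: it
  is the weight of the Wronskian, k for each of the n columns plus 2(0+1+...+(n-1)) for the
  derivatives, and it is twelve times the sum of the roots of the n-th indicial polynomial, since a
  Serre derivative of weight w shifts the exponent by w/12. Multiplying each minor by five
  Wronskians, instead of dividing by one, keeps all coefficients holomorphic and gives them the
  trivial multiplier of a sixth power.\<close>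

lemma open_compl_Ints: "open (- (\<int> :: complex set))"
  by (simp add: closed_Ints open_Compl)

lemma one_minus_notin_Ints:
  assumes "(z::complex) \<notin> \<int>"
  shows "1 - z \<notin> \<int>"
  using assms by (metis Ints_1 Ints_diff diff_diff_eq2 add_diff_cancel_left')

section \<open>Reflection formulas and the partial fractions of the cotangent\<close>

lemma sin_pi_nonzero:
  assumes "(z::complex) \<notin> \<int>"
  shows "sin (of_real pi * z) \<noteq> 0"
proof
  assume "sin (of_real pi * z) = 0"
  then obtain n where "of_real pi * z = of_real (of_int n * pi)"
    unfolding sin_eq_0 by auto
  then have "z = of_int n" by (simp add: mult.commute)
  with assms show False by simp
qed

text \<open>Logarithmic differentiation of Gamma(z) Gamma(1-z) = pi / sin(pi z); the inner
  derivative of 1 - z produces the minus sign.\<close>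

lemma Digamma_reflection:
  fixes z :: complex
  assumes "z \<notin> \<int>"
  shows "Digamma (1 - z) - Digamma z = of_real pi * cot (of_real pi * z)"
proof -
  have n: "z \<notin> \<int>\<^sub>\<le>\<^sub>0" "1 - z \<notin> \<int>\<^sub>\<le>\<^sub>0"
    using assms one_minus_notin_Ints[OF assms] by (auto dest: nonpos_Ints_Int)
  define s where "s = sin (of_real pi * z)"
  have s: "s \<noteq> 0" using sin_pi_nonzero[OF assms] by (simp add: s_def)
  define G where "G = Gamma z * Gamma (1 - z)"
  have G: "G = of_real pi / s"
    unfolding G_def s_def by (rule Gamma_reflection_complex)
  have "((\<lambda>z. Gamma z * Gamma (1 - z)) has_field_derivative G * (Digamma z - Digamma (1 - z))) (at z)"
    using n unfolding G_def
    by (auto intro!: derivative_eq_intros simp: algebra_simps)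
  moreover have "((\<lambda>z. of_real pi / sin (of_real pi * z)) has_field_derivative
      - (of_real pi)\<^sup>2 * cos (of_real pi * z) / s\<^sup>2) (at z)"
    using s unfolding s_def
    by (auto intro!: derivative_eq_intros simp: power2_eq_square)
  ultimately have "G * (Digamma z - Digamma (1 - z)) = - (of_real pi)\<^sup>2 * cos (of_real pi * z) / s\<^sup>2"
    unfolding Gamma_reflection_complex by (rule DERIV_unique)
  then have "s\<^sup>2 / of_real pi * (G * (Digamma z - Digamma (1 - z))) =
      s\<^sup>2 / of_real pi * (- (of_real pi)\<^sup>2 * cos (of_real pi * z) / s\<^sup>2)"
    by simp
  then have "s * (Digamma z - Digamma (1 - z)) = - of_real pi * cos (of_real pi * z)"
    using s unfolding G by (simp add: power2_eq_square)
  then show ?thesis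
    using s unfolding s_def cot_def by (simp add: field_simps)
qed

text \<open>One further differentiation of the digamma reflection. That identity is known off the
  integers, so the derivative is transferred along the open set \<open>- \<int>\<close>.\<close>

lemma Polygamma_1_reflection:
  fixes z :: complex
  assumes "z \<notin> \<int>"
  shows "Polygamma 1 z + Polygamma 1 (1 - z) = (of_real pi / sin (of_real pi * z))\<^sup>2"
proof -
  have n: "z \<notin> \<int>\<^sub>\<le>\<^sub>0" "1 - z \<notin> \<int>\<^sub>\<le>\<^sub>0"
    using assms one_minus_notin_Ints[OF assms] by (auto dest: nonpos_Ints_Int)
  have s: "sin (of_real pi * z) \<noteq> 0" using sin_pi_nonzero[OF assms] .
  have "((\<lambda>z. Digamma (1 - z) - Digamma z) has_field_derivative
      - Polygamma 1 (1 - z) - Polygamma 1 z) (at z)"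
    using n by (auto intro!: derivative_eq_intros)
  moreover have "((\<lambda>z. Digamma (1 - z) - Digamma z) has_field_derivative
      - (of_real pi / sin (of_real pi * z))\<^sup>2) (at z)"
  proof (rule has_field_derivative_transform_within_open[where S = "- \<int>"])
    show "((\<lambda>z. of_real pi * cot (of_real pi * z)) has_field_derivative
      - (of_real pi / sin (of_real pi * z))\<^sup>2) (at z)"
      by (rule derivative_eq_intros DERIV_cot[THEN DERIV_chain2] s refl)+
        (simp add: power2_eq_square divide_inverse)
  qed (use assms open_compl_Ints Digamma_reflection in auto)
  ultimately have "- Polygamma 1 (1 - z) - Polygamma 1 z = - (of_real pi / sin (of_real pi * z))\<^sup>2"
    by (rule DERIV_unique)
  then show ?thesis by (simp add: algebra_simps)
qed

text \<open>Negative indices are written as -1 - n so that, for a summand depending on i + z, they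
  become up to sign the series at 1 - z of the reflection formulas.\<close>

lemma sum_int_symmetric:
  fixes f :: "int \<Rightarrow> 'a::comm_monoid_add"
  shows "(\<Sum>i\<in>{- int N..int N}. f i) = (\<Sum>n<Suc N. f (int n)) + (\<Sum>n<N. f (- 1 - int n))"
proof (induction N)
  case (Suc N)
  have "{- int (Suc N)..int (Suc N)} = insert (int (Suc N)) (insert (- 1 - int N) {- int N..int N})"
    by auto
  then show ?case using Suc by (simp add: algebra_simps)
qed simp

lemma sum_int_telescope:
  fixes g :: "int \<Rightarrow> 'a::ab_group_add"
  shows "(\<Sum>i\<in>{- int N..int N}. g i - g (i + 1)) = g (- int N) - g (int N + 1)"
  unfolding sum_int_symmetric
  by (induction N) (simp_all add: algebra_simps)

text \<open>The intervals [-N, N] are cofinal among the finite sets of integers. The converse fails,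
  so summability is established separately and this limit then identifies the value.\<close>

lemma has_sum_int_symmetric_LIMSEQ:
  assumes "(f has_sum S) (UNIV :: int set)"
  shows "(\<lambda>N. \<Sum>i\<in>{- int N..int N}. f i) \<longlonglongrightarrow> S"
proof -
  have "filterlim (\<lambda>N. {- int N..int N}) (finite_subsets_at_top UNIV) sequentially"
    unfolding filterlim_finite_subsets_at_top
  proof (intro allI impI)
    fix X :: "int set" assume X: "finite X \<and> X \<subseteq> UNIV"
    obtain B where B: "\<forall>x\<in>X. \<bar>x\<bar> \<le> B"
      using X by (metis finite_imageI Max_ge imageI)
    show "\<forall>\<^sub>F N in sequentially. finite {- int N..int N} \<and> X \<subseteq> {- int N..int N} \<and> {- int N..int N} \<subseteq> UNIV"
      using eventually_ge_at_top[of "nat B"]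
      by eventually_elim (use B in force)
  qed
  then show ?thesis
    using assms unfolding has_sum_def by (auto intro: filterlim_compose)
qed

text \<open>The series is not absolutely convergent, hence the symmetric partial sums. They are the
  difference of the sequences defining \<open>Digamma (1 - z)\<close> and \<open>Digamma z\<close>,
  where the logarithms cancel, plus the term i = N, which tends to 0.\<close>

lemma cot_partial_fractions:
  fixes z :: complex
  assumes "z \<notin> \<int>"
  shows "(\<lambda>N. \<Sum>i\<in>{- int N..int N}. 1 / (of_int i + z)) \<longlonglongrightarrow> of_real pi * cot (of_real pi * z)"
proof -
  have nz: "z \<noteq> 0" "1 - z \<noteq> 0" using assms by auto
  let ?l = "\<lambda>m. of_real (ln (real m)) :: complex"
  have 1: "(\<lambda>N. ?l N - (\<Sum>n<N. inverse (1 - z + of_nat n))) \<longlonglongrightarrow> Digamma (1 - z)"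
    by (rule Digamma_LIMSEQ[OF nz(2)])
  have 2: "(\<lambda>N. ?l N - (\<Sum>n<N. inverse (z + of_nat n))) \<longlonglongrightarrow> Digamma z"
    by (rule Digamma_LIMSEQ[OF nz(1)])
  have 3: "(\<lambda>N. inverse (of_nat N + z)) \<longlonglongrightarrow> 0"
    by (intro tendsto_inverse_0[THEN filterlim_compose] tendsto_add_filterlim_at_infinity'[OF _ tendsto_const]
        tendsto_of_nat)
  have "(\<lambda>N. (?l N - (\<Sum>n<N. inverse (1 - z + of_nat n))) - (?l N - (\<Sum>n<N. inverse (z + of_nat n))) + inverse (of_nat N + z))
     \<longlonglongrightarrow> Digamma (1 - z) - Digamma z + 0"
    by (intro tendsto_intros 1 2 3)
  moreover have "(\<Sum>i\<in>{- int N..int N}. 1 / (of_int i + z)) =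
     (?l N - (\<Sum>n<N. inverse (1 - z + of_nat n))) - (?l N - (\<Sum>n<N. inverse (z + of_nat n))) + inverse (of_nat N + z)" for N
  proof -
    have "(\<Sum>n<N. 1 / (of_int (- 1 - int n) + z)) = - (\<Sum>n<N. inverse (1 - z + of_nat n))"
      unfolding sum_negf[symmetric]
    proof (rule sum.cong)
      fix n :: nat
      have "of_int (- 1 - int n) + z = - (1 - z + of_nat n)" by simp
      then show "1 / (of_int (- 1 - int n) + z) = - inverse (1 - z + of_nat n)"
        by (simp only: inverse_eq_divide divide_minus_right)
    qed simp
    then show ?thesis
      unfolding sum_int_symmetric by (simp add: inverse_eq_divide add.commute)
  qed
  ultimately show ?thesis using Digamma_reflection[OF assms] by simp
qed

section \<open>Absolutely convergent lattice sums\<close>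

lemma UHP_not_Ints: "z \<in> UHP \<Longrightarrow> z \<notin> \<int>"
  unfolding UHP_def by (auto elim!: Ints_cases)

text \<open>With z = x + i y, the quadratic form |s z + t|^2 = (s x + t)^2 + (s y)^2 is positive
  definite in (s, t).\<close>

lemma lattice_norm_bound:
  assumes "z \<in> UHP"
  shows "\<exists>c>0. \<forall>s t. (norm (of_real s * z + of_real t))\<^sup>2 \<ge> c * (s\<^sup>2 + t\<^sup>2)"
proof (intro exI conjI allI)
  define x y where "x = Re z" and "y = Im z"
  have y: "y > 0" using assms by (simp add: UHP_def y_def)
  \<comment> \<open>From t^2 \<le> 2 u^2 + 2 (s x)^2 with u = s x + t: the constant collects the
    coefficients of u^2 and of (s y)^2.\<close>
  define K where "K = 2 + (1 + 2 * x\<^sup>2) / y\<^sup>2"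
  have K: "K > 0" unfolding K_def by (intro add_pos_nonneg) auto
  show "1 / K > 0" using K by simp
  fix s t :: real
  define u where "u = s * x + t"
  have "(norm (of_real s * z + of_real t))\<^sup>2 = u\<^sup>2 + (s * y)\<^sup>2"
    by (simp add: cmod_power2 u_def x_def y_def)
  moreover have "s\<^sup>2 + t\<^sup>2 \<le> K * (u\<^sup>2 + (s * y)\<^sup>2)"
  proof -
    have "t\<^sup>2 \<le> 2 * u\<^sup>2 + 2 * (s * x)\<^sup>2"
      using zero_le_power2[of "u + s * x"] unfolding u_def power2_eq_square by (simp add: algebra_simps)
    then have "s\<^sup>2 + t\<^sup>2 \<le> 2 * u\<^sup>2 + s\<^sup>2 * (1 + 2 * x\<^sup>2)" by (simp add: algebra_simps power_mult_distrib)
    also have "s\<^sup>2 * (1 + 2 * x\<^sup>2) = (1 + 2 * x\<^sup>2) / y\<^sup>2 * (s * y)\<^sup>2"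
      using y by (simp add: power_mult_distrib)
    also have "2 * u\<^sup>2 + \<dots> \<le> K * (u\<^sup>2 + (s * y)\<^sup>2)"
    proof -
      have "0 \<le> (1 + 2 * x\<^sup>2) / y\<^sup>2 * u\<^sup>2" by simp
      then show ?thesis unfolding K_def distrib_left distrib_right
        using zero_le_power2[of "s * y"] by linarith
    qed
    finally show ?thesis .
  qed
  ultimately show "(norm (of_real s * z + of_real t))\<^sup>2 \<ge> 1 / K * (s\<^sup>2 + t\<^sup>2)"
    using K by (simp add: field_simps)
qed

lemma summable_on_int_square: "(\<lambda>n::int. 1 / (1 + (of_int n)\<^sup>2 :: real)) summable_on UNIV"
proof -
  let ?f = "\<lambda>n::int. 1 / (1 + (of_int n)\<^sup>2 :: real)"
  have s: "summable (\<lambda>n::nat. 1 / (1 + (real n)\<^sup>2))"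
  proof (rule summable_comparison_test'[where N = 1])
    show "summable (\<lambda>n. inverse (real n ^ 2))" by (rule inverse_power_summable) simp
    show "norm (1 / (1 + (real n)\<^sup>2)) \<le> inverse (real n ^ 2)" if "n \<ge> 1" for n
      using that by (simp add: inverse_eq_divide frac_le)
  qed
  then have s2: "summable (\<lambda>n::nat. 1 / (1 + (real n + 1)\<^sup>2))"
    by (subst (asm) summable_Suc_iff[symmetric]) (simp add: add.commute)
  have 1: "?f summable_on range int"
    by (subst summable_on_reindex) (use s in \<open>auto simp: o_def summable_on_UNIV_nonneg_real_iff\<close>)
  have inj: "inj (\<lambda>n. - 1 - int n)" by (auto simp: inj_def)
  have sq: "(- 1 - real n)\<^sup>2 = (real n + 1)\<^sup>2" for n by (simp add: power2_eq_square algebra_simps)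
  have 2: "?f summable_on range (\<lambda>n. - 1 - int n)"
    by (subst summable_on_reindex[OF inj])
      (use s2 in \<open>simp add: o_def summable_on_UNIV_nonneg_real_iff sq\<close>)
  have "n \<in> range int \<union> range (\<lambda>n. - 1 - int n)" for n :: int
  proof (cases "n \<ge> 0")
    case True
    then show ?thesis by (metis UnI1 nat_0_le rangeI)
  next
    case False
    then have "n = - 1 - int (nat (- 1 - n))" by simp
    then show ?thesis by blast
  qed
  then have "UNIV = range int \<union> range (\<lambda>n. - 1 - int n)" by blast
  then show ?thesis using summable_on_union[OF 1 2] by simp
qed

lemma summable_on_lattice_row:
  assumes "z \<in> UHP"
  shows "(\<lambda>n::int. 1 / (z + of_int n)\<^sup>2) summable_on UNIV"
proof -
  obtain c where c: "c > 0" "\<And>s t. (norm (of_real s * z + of_real t))\<^sup>2 \<ge> c * (s\<^sup>2 + t\<^sup>2)"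
    using lattice_norm_bound[OF assms] by blast
  have "(\<lambda>n::int. norm (1 / c * (1 / (1 + (of_int n)\<^sup>2)))) summable_on UNIV"
    using summable_on_cmult_right[OF summable_on_int_square, of "1 / c"] c(1) by simp
  then have "(\<lambda>n::int. norm (1 / (z + of_int n)\<^sup>2)) summable_on UNIV"
  proof (rule Infinite_Sum.abs_summable_on_comparison_test)
    fix n :: int
    have p: "0 < c * (1 + (of_int n)\<^sup>2)" using c(1) by (intro mult_pos_pos add_pos_nonneg) auto
    have "norm (1 / (z + of_int n)\<^sup>2) = 1 / (norm (of_real 1 * z + of_real (of_int n)))\<^sup>2"
      by (simp add: norm_divide norm_power)
    also have "\<dots> \<le> 1 / (c * (1 + (of_int n)\<^sup>2))"
      using c(2)[of 1 "of_int n"] p by (intro divide_left_mono) (auto intro: mult_pos_pos less_le_trans)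
    finally show "norm (1 / (z + of_int n)\<^sup>2) \<le> norm (1 / c * (1 / (1 + (of_int n)\<^sup>2)))"
      using c(1) by (simp add: abs_mult)
  qed
  then show ?thesis by (rule abs_summable_summable)
qed

text \<open>The value is read off from symmetric partial sums: indices n \<ge> 0 give
  \<open>Polygamma 1 z\<close>, negative ones \<open>Polygamma 1 (1 - z)\<close>.\<close>

lemma has_sum_lattice_row:
  assumes "z \<in> UHP"
  shows "((\<lambda>n::int. 1 / (z + of_int n)\<^sup>2) has_sum (of_real pi / sin (of_real pi * z))\<^sup>2) UNIV"
proof -
  have nz: "z \<notin> \<int>" by (rule UHP_not_Ints[OF assms])
  then have nz': "z \<noteq> 0" "1 - z \<noteq> 0" by auto
  obtain S where S: "((\<lambda>n::int. 1 / (z + of_int n)\<^sup>2) has_sum S) UNIV"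
    using summable_on_lattice_row[OF assms] by (auto simp: summable_on_def)
  have 1: "(\<lambda>k. inverse ((z + of_nat k)\<^sup>2)) sums Polygamma 1 z"
    using Polygamma_LIMSEQ[OF nz'(1), of 1] by (simp add: numeral_2_eq_2)
  have 2: "(\<lambda>k. inverse ((1 - z + of_nat k)\<^sup>2)) sums Polygamma 1 (1 - z)"
    using Polygamma_LIMSEQ[OF nz'(2), of 1] by (simp add: numeral_2_eq_2)
  have "(\<lambda>N. (\<Sum>k<Suc N. inverse ((z + of_nat k)\<^sup>2)) + (\<Sum>k<N. inverse ((1 - z + of_nat k)\<^sup>2)))
     \<longlonglongrightarrow> Polygamma 1 z + Polygamma 1 (1 - z)"
    by (intro tendsto_add LIMSEQ_Suc[OF 1[unfolded sums_def]] 2[unfolded sums_def])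
  moreover have "(\<Sum>i\<in>{- int N..int N}. 1 / (z + of_int i)\<^sup>2) =
     (\<Sum>k<Suc N. inverse ((z + of_nat k)\<^sup>2)) + (\<Sum>k<N. inverse ((1 - z + of_nat k)\<^sup>2))" for N
  proof -
    have "(z + of_int (- 1 - int n))\<^sup>2 = (1 - z + of_nat n)\<^sup>2" for n
      by (simp add: power2_eq_square algebra_simps)
    then show ?thesis
      unfolding sum_int_symmetric by (simp add: inverse_eq_divide)
  qed
  ultimately have "(\<lambda>N. \<Sum>i\<in>{- int N..int N}. 1 / (z + of_int i)\<^sup>2) \<longlonglongrightarrow> Polygamma 1 z + Polygamma 1 (1 - z)"
    by simp
  then have "S = Polygamma 1 z + Polygamma 1 (1 - z)"
    using has_sum_int_symmetric_LIMSEQ[OF S] LIMSEQ_unique by blast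
  then show ?thesis using S Polygamma_1_reflection[OF nz] by simp
qed

section \<open>From lattice rows to the divisor sums in \<open>E2\<close>\<close>

lemma qpow_of_nat: "qpow (real n) z = exp (2 * of_real pi * \<i> * z) ^ n"
  unfolding qpow_def by (simp add: exp_of_nat_mult[symmetric] algebra_simps)

lemma norm_exp_2pi_less_1: "z \<in> UHP \<Longrightarrow> norm (exp (2 * of_real pi * \<i> * z)) < 1"
  by (simp add: UHP_def)

lemma sin_pi_squared_q:
  assumes "z \<in> UHP"
  defines "q \<equiv> exp (2 * of_real pi * \<i> * z)"
  shows "(of_real pi / sin (of_real pi * z))\<^sup>2 = - 4 * (of_real pi)\<^sup>2 * (q / (1 - q)\<^sup>2)"
proof -
  define e where "e = exp (\<i> * (of_real pi * z))"
  have q: "q = e\<^sup>2" unfolding q_def e_def by (simp add: exp_double[symmetric] algebra_simps)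
  have e: "e \<noteq> 0" unfolding e_def by simp
  have q1: "1 - e\<^sup>2 \<noteq> 0" using norm_exp_2pi_less_1[OF assms(1)] q unfolding q_def by auto
  have s: "sin (of_real pi * z) = \<i> * (1 - e\<^sup>2) / (2 * e)"
    unfolding sin_exp_eq e_def
    by (simp add: exp_minus power2_eq_square divide_simps) (simp add: algebra_simps)
  show ?thesis using e q1 unfolding q s
    by (simp add: power_divide power_mult_distrib)
qed

text \<open>A Lambert series: x/(1 - x)^2 is the sum of d x^d over d \<ge> 1. With x = q^m, the
  double sum of d q^(m d) is summed by rows in one case and collected by n = m d in the
  other.\<close>

lemma has_sum_divisor_double_sum:
  fixes q :: complex
  assumes "norm q < 1"
  shows "\<exists>S. ((\<lambda>m::nat. q ^ Suc m / (1 - q ^ Suc m)\<^sup>2) has_sum S) UNIV \<and>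
             ((\<lambda>n. of_nat (sigma1 (Suc n)) * q ^ Suc n) sums S)"
proof -
  define r where "r = norm q"
  have r: "0 \<le> r" "r < 1" using assms by (auto simp: r_def)
  define f where "f = (\<lambda>(m::nat, d::nat). of_nat (Suc d) * q ^ (Suc m * Suc d))"
  have "(\<lambda>d. real (Suc d) * r ^ d) sums (1 / (1 - r)\<^sup>2)"
    using geometric_deriv_sums[of r] r by simp
  then have s1: "(\<lambda>d. real (Suc d) * r ^ d) summable_on UNIV"
    using r by (subst summable_on_UNIV_nonneg_real_iff) (auto simp: sums_iff)
  have s2: "(\<lambda>m. r ^ m) summable_on UNIV"
    using r by (subst summable_on_UNIV_nonneg_real_iff) (auto simp: summable_geometric_iff)
  have "(\<lambda>(m::nat, d::nat). r ^ m * (real (Suc d) * r ^ d)) summable_on UNIV \<times> UNIV"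
    using r by (intro summable_on_SigmaI[where g = "\<lambda>m. r ^ m * (\<Sum>\<^sub>\<infinity>d. real (Suc d) * r ^ d)"]
        summable_on_cmult_left s2) (auto intro!: has_sum_cmult_right has_sum_infsum s1 simp del: of_nat_Suc)
  then have "(\<lambda>x. norm (case x of (m, d) \<Rightarrow> r ^ m * (real (Suc d) * r ^ d))) summable_on UNIV \<times> UNIV"
    using r by (simp add: case_prod_unfold abs_mult)
  then have "(\<lambda>x. norm (f x)) summable_on UNIV \<times> UNIV"
  proof (rule Infinite_Sum.abs_summable_on_comparison_test)
    fix x :: "nat \<times> nat"
    obtain m d where x: "x = (m, d)" by (cases x)
    \<comment> \<open>Since (m+1)(d+1) \<ge> m + d, the majorant factors into a geometric series and
      a differentiated one.\<close>
    have "r ^ (Suc m * Suc d) \<le> r ^ (m + d)" using r by (intro power_decreasing) auto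
    then have "real (Suc d) * r ^ (Suc m * Suc d) \<le> real (Suc d) * r ^ (m + d)"
      by (intro mult_left_mono) auto
    moreover have "norm (f x) = real (Suc d) * r ^ (Suc m * Suc d)"
      unfolding x f_def r_def by (simp only: case_prod_conv norm_mult norm_power norm_of_nat)
    ultimately show "norm (f x) \<le> norm (case x of (m, d) \<Rightarrow> r ^ m * (real (Suc d) * r ^ d))"
      using r by (simp add: x power_add abs_mult mult_ac del: mult_Suc)
  qed
  then have "f summable_on UNIV \<times> UNIV" by (rule Infinite_Sum.abs_summable_summable)
  then obtain S where S: "(f has_sum S) (UNIV \<times> UNIV)" by (auto simp: summable_on_def)
  have "((\<lambda>m. q ^ Suc m / (1 - q ^ Suc m)\<^sup>2) has_sum S) UNIV"
  proof (rule has_sum_SigmaD[OF S])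
    fix m :: nat
    define Q where "Q = q ^ Suc m"
    have "r ^ Suc m \<le> r ^ 1" using r by (intro power_decreasing) auto
    then have Q: "norm Q < 1" using r unfolding Q_def r_def norm_power by simp
    have "(\<lambda>d. of_nat (Suc d) * Q ^ d * Q) sums (1 / (1 - Q)\<^sup>2 * Q)"
      by (intro sums_mult2 geometric_deriv_sums Q)
    moreover have "summable (\<lambda>d. norm (of_nat (Suc d) * Q ^ d * Q))"
    proof -
      have "(\<lambda>d. of_nat (Suc d) * norm Q ^ d * norm Q) sums (1 / (1 - norm Q)\<^sup>2 * norm Q)"
        by (intro sums_mult2 geometric_deriv_sums) (use Q in simp)
      then show ?thesis unfolding norm_mult norm_power norm_of_nat by (simp only: sums_iff)
    qed
    ultimately have "((\<lambda>d. of_nat (Suc d) * Q ^ d * Q) has_sum (1 / (1 - Q)\<^sup>2 * Q)) UNIV"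
      by (intro norm_summable_imp_has_sum)
    moreover have "f (m, d) = of_nat (Suc d) * Q ^ d * Q" for d
      unfolding f_def Q_def case_prod_conv power_mult by (simp add: mult_ac)
    ultimately show "((\<lambda>y. f (m, y)) has_sum q ^ Suc m / (1 - q ^ Suc m)\<^sup>2) UNIV"
      by (simp add: Q_def)
  qed
  moreover have "((\<lambda>n. of_nat (sigma1 (Suc n)) * q ^ Suc n) has_sum S) UNIV"
  proof -
    \<comment> \<open>Reindexing by n = m d. All indices are stored as predecessors, except that d
      on this side is the divisor itself.\<close>
    have "((\<lambda>(n, d). of_nat d * q ^ Suc n) has_sum S) (Sigma UNIV (\<lambda>n. {d. d dvd Suc n}))"
    proof (rule iffD1[OF has_sum_reindex_bij_witness[where
        i = "\<lambda>(n, d). (Suc n div d - 1, d - 1)" and j = "\<lambda>(m, d). (Suc m * Suc d - 1, Suc d)"] S])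
      fix a :: "nat \<times> nat" assume "a \<in> UNIV \<times> UNIV"
      obtain m d where a: "a = (m, d)" by (cases a)
      have p: "Suc (Suc m * Suc d - 1) = Suc m * Suc d" by simp
      show "(case case a of (m, d) \<Rightarrow> (Suc m * Suc d - 1, Suc d) of (n, d) \<Rightarrow> (Suc n div d - 1, d - 1)) = a"
        unfolding a case_prod_conv p by (simp del: mult_Suc mult_Suc_right)
      show "(case a of (m, d) \<Rightarrow> (Suc m * Suc d - 1, Suc d)) \<in> Sigma UNIV (\<lambda>n. {d. d dvd Suc n})"
        unfolding a case_prod_conv mem_Sigma_iff mem_Collect_eq p by (simp del: mult_Suc mult_Suc_right)
      show "(case case a of (m, d) \<Rightarrow> (Suc m * Suc d - 1, Suc d) of (n, d) \<Rightarrow> of_nat d * q ^ Suc n) = f a"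
        unfolding a case_prod_conv p f_def by (simp del: mult_Suc mult_Suc_right)
    next
      fix b :: "nat \<times> nat" assume b': "b \<in> Sigma UNIV (\<lambda>n. {d. d dvd Suc n})"
      obtain n d where b: "b = (n, d)" by (cases b)
      obtain e where e: "Suc n = d * e" using b' b by auto
      have pos: "d > 0" "e > 0" using e by (metis Zero_not_Suc gr0I mult_0 mult_0_right)+
      have "Suc n div d = e" unfolding e using pos by simp
      then show "(case case b of (n, d) \<Rightarrow> (Suc n div d - 1, d - 1) of (m, d) \<Rightarrow> (Suc m * Suc d - 1, Suc d)) = b"
        unfolding b case_prod_conv using pos e by (simp add: mult.commute)
    qed auto
    then show ?thesis
    proof (rule has_sum_SigmaD)
      fix n :: nat
      have fin: "finite {d. d dvd Suc n}" by simp
      have "(\<Sum>d | d dvd Suc n. of_nat d * q ^ Suc n) = of_nat (sigma1 (Suc n)) * q ^ Suc n"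
        unfolding sigma1_def of_nat_sum sum_distrib_right ..
      then show "((\<lambda>y. case (n, y) of (n, d) \<Rightarrow> of_nat d * q ^ Suc n) has_sum
          of_nat (sigma1 (Suc n)) * q ^ Suc n) {d. d dvd Suc n}"
        unfolding case_prod_conv using has_sum_finite[OF fin] by metis
    qed
  qed
  ultimately show ?thesis by (blast dest: has_sum_imp_sums)
qed

lemma has_sum_int_even:
  fixes f :: "int \<Rightarrow> 'a::topological_comm_monoid_add"
  assumes even: "\<And>m. f (- m) = f m" and sum: "((\<lambda>m. f (int (Suc m))) has_sum T) UNIV"
  shows "(f has_sum f 0 + (T + T)) UNIV"
proof -
  have inj: "inj (\<lambda>m. int (Suc m))" "inj (\<lambda>m. - int (Suc m))" by (auto simp: inj_def)
  have pos: "(f has_sum T) (range (\<lambda>m. int (Suc m)))"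
    using sum unfolding has_sum_reindex[OF inj(1)] o_def .
  have neg: "(f has_sum T) (range (\<lambda>m. - int (Suc m)))"
    using sum unfolding has_sum_reindex[OF inj(2)] o_def even .
  have zero: "(f has_sum f 0) {0}" by (rule has_sum_finiteI) simp_all
  have "m \<in> {0} \<union> (range (\<lambda>m. int (Suc m)) \<union> range (\<lambda>m. - int (Suc m)))" for m
  proof -
    consider "m = 0" | "m = int (Suc (nat (m - 1)))" | "m = - int (Suc (nat (- m - 1)))" by linarith
    then show ?thesis by cases blast+
  qed
  then have U: "UNIV = {0} \<union> (range (\<lambda>m. int (Suc m)) \<union> range (\<lambda>m. - int (Suc m)))" by blast
  have "(f has_sum f 0 + (T + T))
      ({0} \<union> (range (\<lambda>m. int (Suc m)) \<union> range (\<lambda>m. - int (Suc m))))"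
    by (intro has_sum_Un_disjoint zero pos neg) (auto simp: image_iff)
  then show ?thesis unfolding U[symmetric] .
qed

text \<open>The sum over \<open>n\<close> of \<open>1 / (m z + n)\<^sup>2\<close>, without the term \<open>n = 0\<close> in the row \<open>m = 0\<close>.\<close>
definition Eis_row :: "complex \<Rightarrow> int \<Rightarrow> complex" where
  "Eis_row z m = (if m = 0 then (of_real pi)\<^sup>2 / 3 else (of_real pi / sin (of_real pi * (of_int m * z)))\<^sup>2)"

text \<open>Row 0 gives pi^2/3 = 2 zeta(2), and the rows m and -m agree. A positive row is -4 pi^2
  q^m/(1 - q^m)^2, and -8 pi^2 = -24 pi^2/3 accounts for the factor 24 in \<open>E2\<close>.\<close>

lemma has_sum_Eis_row:
  assumes "z \<in> UHP"
  shows "(Eis_row z has_sum (of_real pi)\<^sup>2 / 3 * E2 z) UNIV"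
proof -
  define q where "q = exp (2 * of_real pi * \<i> * z)"
  obtain S where S: "((\<lambda>m. q ^ Suc m / (1 - q ^ Suc m)\<^sup>2) has_sum S) UNIV"
      "(\<lambda>n. of_nat (sigma1 (Suc n)) * q ^ Suc n) sums S"
    using has_sum_divisor_double_sum[of q] norm_exp_2pi_less_1[OF assms] unfolding q_def by blast
  have E2: "E2 z = 1 - 24 * S"
    unfolding E2_def qpow_of_nat q_def[symmetric] using S(2) by (simp only: sums_iff)
  define T where "T = - 4 * (of_real pi)\<^sup>2 * S"
  have T: "((\<lambda>m. - 4 * (of_real pi)\<^sup>2 * (q ^ Suc m / (1 - q ^ Suc m)\<^sup>2)) has_sum T) UNIV"
    unfolding T_def by (intro has_sum_cmult_right S)
  have row: "Eis_row z (int (Suc m)) = - 4 * (of_real pi)\<^sup>2 * (q ^ Suc m / (1 - q ^ Suc m)\<^sup>2)" for m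
  proof -
    have "of_nat (Suc m) * z \<in> UHP" using assms by (simp add: UHP_def add_pos_nonneg algebra_simps)
    note * = sin_pi_squared_q[OF this]
    have "exp (2 * of_real pi * \<i> * (of_nat (Suc m) * z)) = q ^ Suc m"
      unfolding q_def exp_of_nat_mult[symmetric] by (simp add: algebra_simps)
    then show ?thesis using * unfolding Eis_row_def by simp
  qed
  have minus: "Eis_row z (- m) = Eis_row z m" for m
    unfolding Eis_row_def by (simp add: power_divide)
  have "(Eis_row z has_sum Eis_row z 0 + (T + T)) UNIV"
    by (rule has_sum_int_even) (use T row minus in simp_all)
  then have s: "(Eis_row z has_sum (of_real pi)\<^sup>2 / 3 + (T + T)) UNIV"
    by (simp add: Eis_row_def)
  have e: "(of_real pi)\<^sup>2 / 3 + (T + T) = (of_real pi)\<^sup>2 / 3 * E2 z"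
    unfolding T_def E2 by (simp add: algebra_simps)
  show ?thesis using s unfolding e .
qed

text \<open>The convention \<open>1 / 0 = 0\<close> removes the term \<open>m = n = 0\<close>.\<close>
lemma has_sum_Eis_row_terms:
  assumes "z \<in> UHP"
  shows "((\<lambda>n. 1 / (of_int m * z + of_int n)\<^sup>2) has_sum Eis_row z m) UNIV"
proof -
  consider "m = 0" | "m > 0" | "m < 0" by linarith
  then show ?thesis
  proof cases
    case 1
    let ?f = "\<lambda>n::int. 1 / (of_int n)\<^sup>2 :: complex"
    have "(\<lambda>n. of_real (1 / (real n + 1)\<^sup>2)) sums (of_real (pi\<^sup>2 / 6) :: complex)"
      using inverse_squares_sums by (intro sums_of_real) (simp add: add.commute)
    then have "(\<lambda>n. ?f (int (Suc n))) sums ((of_real pi)\<^sup>2 / 6)"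
      by (simp add: add.commute)
    moreover have "summable (\<lambda>n. norm (?f (int (Suc n))))"
    proof -
      have "norm (?f (int (Suc n))) = 1 / (real n + 1)\<^sup>2" for n
        by (simp add: norm_divide norm_power del: of_nat_Suc)
      moreover have "summable (\<lambda>n. 1 / (real n + 1)\<^sup>2)"
        using inverse_squares_sums by (simp add: sums_iff add.commute)
      ultimately show ?thesis by simp
    qed
    ultimately have s: "((\<lambda>n. ?f (int (Suc n))) has_sum (of_real pi)\<^sup>2 / 6) UNIV"
      by (intro norm_summable_imp_has_sum)
    have "(?f has_sum ?f 0 + ((of_real pi)\<^sup>2 / 6 + (of_real pi)\<^sup>2 / 6)) UNIV"
      using s by (intro has_sum_int_even) simp_all
    then show ?thesis using 1 by (simp add: Eis_row_def)
  next
    case 2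
    then have "of_int m * z \<in> UHP" using assms by (simp add: UHP_def)
    from has_sum_lattice_row[OF this] show ?thesis using 2 by (simp add: Eis_row_def)
  next
    case 3
    then have "of_int (- m) * z \<in> UHP" using assms by (simp add: UHP_def mult_neg_pos)
    from has_sum_lattice_row[OF this]
    have "((\<lambda>n. 1 / (of_int (- m) * z + of_int n)\<^sup>2) has_sum Eis_row z m) UNIV"
      using 3 by (simp add: Eis_row_def power_divide)
    then have "((\<lambda>n. 1 / (of_int (- m) * z + of_int (- n))\<^sup>2) has_sum Eis_row z m) UNIV"
      by (subst has_sum_reindex_bij_betw[where g = uminus and f = "\<lambda>n. 1 / (of_int (- m) * z + of_int n)\<^sup>2"])
        (auto intro: bij_uminus)
    moreover have "(of_int (- m) * z + of_int (- n))\<^sup>2 = (of_int m * z + of_int n)\<^sup>2" for n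
      by (simp add: power2_eq_square algebra_simps)
    ultimately show ?thesis by simp
  qed
qed

section \<open>The two orders of summation of the lattice series of weight 2\<close>

lemma has_sum_telescope:
  fixes g :: "int \<Rightarrow> complex"
  assumes "(\<lambda>n. g n - g (n + 1)) summable_on UNIV"
    and "(\<lambda>N. g (- int N) - g (int N + 1)) \<longlonglongrightarrow> L"
  shows "((\<lambda>n. g n - g (n + 1)) has_sum L) UNIV"
proof -
  obtain S where S: "((\<lambda>n. g n - g (n + 1)) has_sum S) UNIV"
    using assms(1) by (auto simp: summable_on_def)
  from has_sum_int_symmetric_LIMSEQ[OF S] have "S = L"
    unfolding sum_int_telescope using assms(2) LIMSEQ_unique by blast
  with S show ?thesis by simp
qed

lemma has_sum_minus:
  fixes f g :: "'a \<Rightarrow> 'b::real_normed_vector"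
  assumes "(f has_sum a) A" "(g has_sum b) A"
  shows "((\<lambda>x. f x - g x) has_sum (a - b)) A"
  using has_sum_add[OF assms(1) has_sum_uminus[THEN iffD2], of g "- b"] assms(2) by simp

text \<open>Keeps the comparison terms 1/((m z + n)^2 - 1/4) free of poles: at a pole a half-integer
  would be an integral multiple of z.\<close>

lemma half_integer_multiple_notin_Ints:
  fixes z :: complex
  assumes "z \<in> UHP"
  shows "(of_int n - 1/2) / z \<notin> \<int>"
proof
  assume "(of_int n - 1/2) / z \<in> \<int>"
  then obtain j where j: "(of_int n - 1/2) / z = of_int j" by (auto elim: Ints_cases)
  have z: "z \<noteq> 0" "Im z \<noteq> 0" using assms by (auto simp: UHP_def)
  have eq: "of_int n - 1/2 = of_int j * z" using j z by (simp add: field_simps)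
  then have "Im (of_int n - 1/2) = Im (of_int j * z)" by (rule arg_cong)
  then have "j = 0" using z by simp
  with eq have "of_int n = (1/2 :: complex)" by simp
  then have "of_int (2 * n) = (of_int 1 :: complex)" by (simp add: mult.commute)
  then have "2 * n = 1" unfolding of_int_eq_iff .
  then show False by presburger
qed

text \<open>Written with exp(-2 i w), which is small far down in the lower half plane. At the poles
  both sides are 0 by division by zero.\<close>

lemma cot_exp_eq:
  fixes w :: complex
  shows "cot w = \<i> * (1 + exp (- 2 * \<i> * w)) / (1 - exp (- 2 * \<i> * w))"
proof -
  define e where "e = exp (\<i> * w)"
  have e: "e \<noteq> 0" by (simp add: e_def)
  have e2: "exp (- 2 * \<i> * w) = 1 / e\<^sup>2"
  proof -
    have "exp (- (2 * (\<i> * w))) = 1 / e\<^sup>2"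
      unfolding e_def exp_double[symmetric] by (simp only: exp_minus inverse_eq_divide)
    then show ?thesis by (simp add: mult.assoc)
  qed
  have s: "sin w = (e - 1 / e) / (2 * \<i>)" and c: "cos w = (e + 1 / e) / 2"
    unfolding sin_exp_eq cos_exp_eq e_def by (simp_all add: exp_minus inverse_eq_divide)
  show ?thesis unfolding cot_def s c e2
  proof (cases "e\<^sup>2 = 1")
    case True
    then have "e - 1 / e = 0" using e by (simp add: field_simps power2_eq_square)
    then show "(e + 1 / e) / 2 / ((e - 1 / e) / (2 * \<i>)) = \<i> * (1 + 1 / e\<^sup>2) / (1 - 1 / e\<^sup>2)"
      using True by simp
  next
    case False
    then have "e - 1 / e \<noteq> 0" using e by (simp add: field_simps power2_eq_square)
    then show "(e + 1 / e) / 2 / ((e - 1 / e) / (2 * \<i>)) = \<i> * (1 + 1 / e\<^sup>2) / (1 - 1 / e\<^sup>2)"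
      using False e by (simp add: power2_eq_square field_simps)
  qed
qed

text \<open>1/z lies in the lower half plane, so the arguments move off in a direction where the
  cotangent tends to i. In the proof \<open>r\<close> is the factor gained per unit step of N and
  \<open>k\<close> the initial half step.\<close>

lemma cot_half_integer_LIMSEQ:
  assumes "z \<in> UHP"
  shows "(\<lambda>N. cot (of_real pi * ((of_nat N + 1/2) / z))) \<longlonglongrightarrow> \<i>"
proof -
  define r k where "r = exp (- 2 * \<i> * of_real pi / z)" and "k = exp (- \<i> * of_real pi / z)"
  have "Im z > 0" using assms by (simp add: UHP_def)
  then have "norm r < 1" unfolding r_def
    by (auto simp: Re_divide intro!: divide_pos_pos mult_pos_pos add_nonneg_pos)
  then have r: "(\<lambda>N. r ^ N) \<longlonglongrightarrow> 0" by (rule LIMSEQ_power_zero)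
  have "(\<lambda>N. \<i> * (1 + k * r ^ N) / (1 - k * r ^ N)) \<longlonglongrightarrow> \<i> * (1 + k * 0) / (1 - k * 0)"
    by (intro tendsto_divide tendsto_mult tendsto_add tendsto_diff tendsto_const r) simp
  moreover have "exp (- 2 * \<i> * (of_real pi * ((of_nat N + 1/2) / z))) = k * r ^ N" for N
    unfolding k_def r_def exp_of_nat_mult[symmetric] exp_add[symmetric]
    by (rule arg_cong[where f = exp]) (simp add: ring_distribs add_divide_distrib mult_ac)
  ultimately show ?thesis unfolding cot_exp_eq by simp
qed

text \<open>For x = m z + n the difference equals (1/4)/((x^2 - 1/4) x^2). Its order |x|^(-4)
  suffices for absolute convergence over both indices, unlike |x|^(-2).\<close>

lemma lattice_term_bound:
  assumes "z \<in> UHP"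
  shows "\<exists>C>0. \<forall>m n::int. norm (1 / ((of_int m * z + of_int n)\<^sup>2 - 1/4) - 1 / (of_int m * z + of_int n)\<^sup>2)
     \<le> C * (1 / (1 + (of_int m)\<^sup>2) * (1 / (1 + (of_int n)\<^sup>2)))"
proof -
  obtain c where c: "c > 0" "\<And>s t. (norm (of_real s * z + of_real t))\<^sup>2 \<ge> c * (s\<^sup>2 + t\<^sup>2)"
    using lattice_norm_bound[OF assms] by blast
  \<comment> \<open>4 covers m = n = 0, where the first fraction is -4 and the second is 1/0 = 0;
    4/c^2 covers the other lattice points.\<close>
  define C where "C = 4 + 4 / c\<^sup>2"
  have C: "C > 0" using c by (simp add: C_def add_pos_nonneg)
  have "norm (1 / ((of_int m * z + of_int n)\<^sup>2 - 1/4) - 1 / (of_int m * z + of_int n)\<^sup>2)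
     \<le> C * (1 / (1 + (of_int m)\<^sup>2) * (1 / (1 + (of_int n)\<^sup>2)))" for m n :: int
  proof (cases "m = 0 \<and> n = 0")
    case True
    then show ?thesis using c by (simp add: C_def)
  next
    case False
    define s t where "s = real_of_int m" and "t = real_of_int n"
    define x where "x = of_real s * z + of_real t"
    define Q where "Q = s\<^sup>2 + t\<^sup>2"
    have Q1: "Q \<ge> 1"
    proof -
      have "m\<^sup>2 + n\<^sup>2 > 0" using False by (simp add: sum_power2_gt_zero_iff)
      then have "1 \<le> m\<^sup>2 + n\<^sup>2" by linarith
      then have "real_of_int 1 \<le> real_of_int (m\<^sup>2 + n\<^sup>2)" by (simp only: of_int_le_iff)
      then show ?thesis by (simp add: Q_def s_def t_def)
    qed
    \<comment> \<open>For an integer t, a shift by one half loses at most half of |t|, so x + 1/2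
      and x - 1/2 obey the same kind of lower bound as x.\<close>
    have half: "(t + h)\<^sup>2 \<ge> t\<^sup>2 / 4" if "h = 1/2 \<or> h = -1/2" for h
    proof -
      have "n = 0 \<or> n \<ge> 1 \<or> n \<le> -1" by linarith
      then have "\<bar>t + h\<bar> \<ge> \<bar>t\<bar> / 2" using that unfolding t_def by auto
      then have "(\<bar>t\<bar> / 2)\<^sup>2 \<le> \<bar>t + h\<bar>\<^sup>2" by (intro power_mono) auto
      then show ?thesis by (simp add: power_divide)
    qed
    have b: "(norm (x + of_real h))\<^sup>2 \<ge> c * Q / 4" if "h = 1/2 \<or> h = -1/2" for h
    proof -
      have "s\<^sup>2 + (t + h)\<^sup>2 \<ge> Q / 4" using half[OF that] zero_le_power2[of s] unfolding Q_def by argo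
      then have "c * (Q / 4) \<le> c * (s\<^sup>2 + (t + h)\<^sup>2)" using c(1) by (intro mult_left_mono) auto
      also have "\<dots> \<le> (norm (of_real s * z + of_real (t + h)))\<^sup>2" by (rule c(2))
      finally show ?thesis by (simp add: x_def add.assoc)
    qed
    have cQ: "c * Q > 0" using c Q1 by simp
    have f: "x\<^sup>2 - 1/4 = (x + of_real (1/2)) * (x + of_real (-1/2))"
      by (simp add: power2_eq_square algebra_simps)
    have "(c * Q / 4)\<^sup>2 \<le> (norm (x\<^sup>2 - 1/4))\<^sup>2"
      unfolding f norm_mult power_mult_distrib power2_eq_square[of "c * Q / 4"]
      using cQ by (intro mult_mono b) auto
    then have n1: "c * Q / 4 \<le> norm (x\<^sup>2 - 1/4)"
      by (rule power2_le_imp_le) simp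
    have n2: "c * Q \<le> norm (x\<^sup>2)"
      unfolding norm_power x_def Q_def by (rule c(2))
    have "norm (x\<^sup>2) > 0" "norm (x\<^sup>2 - 1/4) > 0" using n1 n2 cQ by linarith+
    then have nz: "x\<^sup>2 \<noteq> 0" "x\<^sup>2 - 1/4 \<noteq> 0" unfolding zero_less_norm_iff .
    have "1 / (x\<^sup>2 - 1/4) - 1 / x\<^sup>2 = (1/4) / ((x\<^sup>2 - 1/4) * x\<^sup>2)"
      using nz by (simp add: field_simps)
    then have "norm (1 / (x\<^sup>2 - 1/4) - 1 / x\<^sup>2) = (1/4) / (norm (x\<^sup>2 - 1/4) * norm (x\<^sup>2))"
      by (simp add: norm_divide norm_mult)
    also have "\<dots> \<le> (1/4) / (c * Q / 4 * (c * Q))"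
    proof (rule divide_left_mono)
      show "c * Q / 4 * (c * Q) \<le> norm (x\<^sup>2 - 1/4) * norm (x\<^sup>2)"
        using cQ by (intro mult_mono n1 n2) auto
      then show "0 < norm (x\<^sup>2 - 1/4) * norm (x\<^sup>2) * (c * Q / 4 * (c * Q))"
        using nz c(1) less_le_trans[OF zero_less_one Q1]
        by (intro mult_pos_pos divide_pos_pos) (simp_all only: zero_less_norm_iff not_False_eq_True zero_less_numeral simp_thms)
    qed simp
    also have "\<dots> = 1 / c\<^sup>2 * (1 / Q\<^sup>2)" using c by (simp add: field_simps power2_eq_square)
    also have "\<dots> \<le> 1 / c\<^sup>2 * (4 * (1 / ((1 + s\<^sup>2) * (1 + t\<^sup>2))))"
    proof (rule mult_left_mono)
      have 1: "1 + s\<^sup>2 \<le> 2 * Q" "1 + t\<^sup>2 \<le> 2 * Q"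
        using Q1 zero_le_power2[of s] zero_le_power2[of t] unfolding Q_def distrib_left by argo+
      have p: "0 < 1 + s\<^sup>2" "0 < 1 + t\<^sup>2" by (auto intro: add_pos_nonneg)
      have "(1 + s\<^sup>2) * (1 + t\<^sup>2) \<le> (2 * Q) * (2 * Q)"
        using p Q1 by (intro mult_mono 1) auto
      then have "(1 + s\<^sup>2) * (1 + t\<^sup>2) \<le> 4 * Q\<^sup>2" by (simp add: power2_eq_square)
      then show "1 / Q\<^sup>2 \<le> 4 * (1 / ((1 + s\<^sup>2) * (1 + t\<^sup>2)))"
        using p Q1 by (simp add: divide_simps del: distrib_left_numeral)
    qed simp
    also have "\<dots> \<le> C * (1 / (1 + s\<^sup>2) * (1 / (1 + t\<^sup>2)))"
    proof -
      define W where "W = 1 / ((1 + s\<^sup>2) * (1 + t\<^sup>2))"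
      have "W \<ge> 0" unfolding W_def
        by (intro mult_nonneg_nonneg divide_nonneg_nonneg add_nonneg_nonneg) auto
      moreover have "1 / (1 + s\<^sup>2) * (1 / (1 + t\<^sup>2)) = W"
        unfolding W_def by (simp only: times_divide_times_eq mult_1)
      ultimately show ?thesis unfolding C_def W_def[symmetric] by (simp add: distrib_right)
    qed
    finally show ?thesis by (simp add: x_def s_def t_def)
  qed
  with C show ?thesis by blast
qed

text \<open>The sums over \<open>m\<close> and over \<open>n\<close> of \<open>1 / (m z + n)\<^sup>2\<close> do not commute. After subtracting it from the
  telescoping \<open>1 / ((m z + n)\<^sup>2 - 1/4)\<close> the double series converges absolutely. The comparison
  terms contribute nothing when summed over \<open>n\<close> first, and \<open>- 2 \<pi> \<i> / z\<close> when summed over \<open>m\<close>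
  first.\<close>
theorem E2_S:
  assumes "z \<in> UHP"
  shows "E2 (- 1 / z) = z\<^sup>2 * E2 z + 6 * z / (of_real pi * \<i>)"
proof -
  define z' where "z' = - 1 / z"
  have z: "z \<noteq> 0" "Im z > 0" using assms by (auto simp: UHP_def)
  have z': "z' \<in> UHP"
    using z by (simp add: z'_def UHP_def Im_divide) (simp add: add_nonneg_pos)
  define d where "d = (\<lambda>(m::int, n::int). 1 / ((of_int m * z + of_int n)\<^sup>2 - 1/4) - 1 / (of_int m * z + of_int n)\<^sup>2)"
  obtain C where C: "C > 0" "\<And>m n. norm (d (m, n)) \<le> C * (1 / (1 + (of_int m)\<^sup>2) * (1 / (1 + (of_int n)\<^sup>2)))"
    using lattice_term_bound[OF assms] unfolding d_def case_prod_conv by blast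
  let ?h = "\<lambda>n::int. 1 / (1 + (of_int n)\<^sup>2) :: real"
  have "(\<lambda>(m, n). C * (?h m * ?h n)) summable_on UNIV \<times> UNIV"
    using C(1)
    by (intro summable_on_SigmaI[where g = "\<lambda>m. C * (?h m * infsum ?h UNIV)"]
        summable_on_cmult_right summable_on_cmult_left summable_on_int_square)
      (auto intro!: has_sum_cmult_right has_sum_infsum summable_on_int_square simp del: times_divide_eq_right times_divide_eq_left)
  then have "(\<lambda>x. norm ((case x of (m, n) \<Rightarrow> C * (?h m * ?h n)) :: real)) summable_on UNIV \<times> UNIV"
    using C(1) by (simp add: case_prod_unfold abs_mult)
  then have "(\<lambda>x. norm (d x)) summable_on UNIV \<times> UNIV"
    by (rule Infinite_Sum.abs_summable_on_comparison_test) (use C in \<open>auto simp: abs_mult\<close>)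
  then have dsum: "d summable_on UNIV \<times> UNIV" by (rule Infinite_Sum.abs_summable_summable)
  then obtain T where T: "(d has_sum T) (UNIV \<times> UNIV)" by (auto simp: summable_on_def)
  \<comment> \<open>The swap is legitimate because \<open>d\<close> is absolutely summable; what
    follows evaluates \<open>T\<close> in both orders.\<close>
  have T': "((\<lambda>(n, m). d (m, n)) has_sum T) (UNIV \<times> UNIV)"
    using T by (subst (asm) has_sum_swap) simp
  have b_eq: "1 / ((of_int m * z + of_int n)\<^sup>2 - 1/4) =
      1 / (of_int m * z + (of_int n - 1/2)) - 1 / (of_int m * z + (of_int (n + 1) - 1/2))" for m n :: int
  proof -
    have nz: "of_int m * z + (of_int n - 1/2) \<noteq> 0" for n :: int
    proof
      assume "of_int m * z + (of_int n - 1/2) = 0"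
      then have "(of_int n - 1/2) / z = of_int (- m)" using z
        by (simp add: field_simps add_eq_0_iff)
      then show False using half_integer_multiple_notin_Ints[OF assms, of n] by (metis Ints_of_int)
    qed
    define x where "x = of_int m * z + of_int n"
    have "x - 1/2 \<noteq> 0" "x + 1/2 \<noteq> 0" using nz[of n] nz[of "n + 1"] by (simp_all add: x_def algebra_simps)
    moreover from this have "x\<^sup>2 - 1/4 \<noteq> 0"
    proof -
      have "x\<^sup>2 - 1/4 = (x - 1/2) * (x + 1/2)" by (simp add: power2_eq_square algebra_simps)
      then show ?thesis using \<open>x - 1/2 \<noteq> 0\<close> \<open>x + 1/2 \<noteq> 0\<close> by simp
    qed
    ultimately have "1 / (x\<^sup>2 - 1/4) = 1 / (x - 1/2) - 1 / (x + 1/2)"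
      by (simp add: divide_simps) (simp add: algebra_simps power2_eq_square)
    then show ?thesis by (simp add: x_def algebra_simps)
  qed
  have "((\<lambda>m. - Eis_row z m) has_sum T) UNIV"
  proof (rule has_sum_SigmaD[OF T])
    fix m :: int
    note a = has_sum_Eis_row_terms[OF assms, of m]
    have dm: "(\<lambda>n. d (m, n)) summable_on UNIV"
      using summable_on_SigmaD1[of "\<lambda>m n. d (m, n)" UNIV "\<lambda>_. UNIV" m] dsum by (simp add: case_prod_unfold)
    define g where "g = (\<lambda>n::int. 1 / (of_int m * z + (of_int n - 1/2)))"
    have eq: "d (m, n) + 1 / (of_int m * z + of_int n)\<^sup>2 = g n - g (n + 1)" for n
      unfolding g_def d_def case_prod_conv b_eq[symmetric] by simp
    have "(\<lambda>n. d (m, n) + 1 / (of_int m * z + of_int n)\<^sup>2) summable_on UNIV"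
      using a by (intro summable_on_add dm) (auto simp: summable_on_def)
    then have "(\<lambda>n. g n - g (n + 1)) summable_on UNIV" unfolding eq .
    moreover have "(\<lambda>N. g (- int N) - g (int N + 1)) \<longlonglongrightarrow> 0 - 0"
    proof (rule tendsto_diff)
      have "(\<lambda>N. inverse ((of_int m * z + 1/2) + of_nat N)) \<longlonglongrightarrow> 0"
        by (intro tendsto_inverse_0[THEN filterlim_compose] tendsto_add_filterlim_at_infinity[OF tendsto_const]
            tendsto_of_nat)
      then show "(\<lambda>N. g (int N + 1)) \<longlonglongrightarrow> 0" by (simp add: g_def inverse_eq_divide algebra_simps)
      have "(\<lambda>N. - inverse ((1/2 - of_int m * z) + of_nat N)) \<longlonglongrightarrow> - 0"
        by (intro tendsto_minus tendsto_inverse_0[THEN filterlim_compose] tendsto_add_filterlim_at_infinity[OF tendsto_const]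
            tendsto_of_nat)
      moreover have "- inverse ((1/2 - of_int m * z) + of_nat N) = g (- int N)" for N
        unfolding g_def by (subst inverse_minus_eq[symmetric]) (simp add: inverse_eq_divide algebra_simps)
      ultimately show "(\<lambda>N. g (- int N)) \<longlonglongrightarrow> 0" by simp
    qed
    ultimately have "((\<lambda>n. g n - g (n + 1)) has_sum 0 - 0) UNIV" by (rule has_sum_telescope)
    from has_sum_minus[OF this a] show "((\<lambda>n. d (m, n)) has_sum - Eis_row z m) UNIV"
      unfolding eq[symmetric] by simp
  qed
  moreover have "((\<lambda>m. - Eis_row z m) has_sum - ((of_real pi)\<^sup>2 / 3 * E2 z)) UNIV"
    using has_sum_Eis_row[OF assms] by (rule has_sum_uminusI)
  ultimately have T1: "T = - ((of_real pi)\<^sup>2 / 3 * E2 z)" by (rule has_sum_unique)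
  \<comment> \<open>The symmetric limit over m of 1/(m z + n - 1/2), by the partial fractions of the
    cotangent. The difference of the terms for n and n + 1 is summable in m.\<close>
  define G where "G = (\<lambda>n::int. of_real pi / z * cot (of_real pi * ((of_int n - 1/2) / z)))"
  have "((\<lambda>n. (G n - G (n + 1)) - 1 / z\<^sup>2 * Eis_row z' n) has_sum T) UNIV"
  proof (rule has_sum_SigmaD[OF T'])
    fix n :: int
    \<comment> \<open>Since (m z + n)^2 = z^2 (n z' - m)^2, a column for z is, up to the factor
      1/z^2, a row for z' = -1/z.\<close>
    have "((\<lambda>m. 1 / z\<^sup>2 * (1 / (of_int n * z' + of_int m)\<^sup>2)) has_sum 1 / z\<^sup>2 * Eis_row z' n) UNIV"
      by (intro has_sum_cmult_right has_sum_Eis_row_terms z')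
    then have "((\<lambda>m. 1 / z\<^sup>2 * (1 / (of_int n * z' + of_int (- m))\<^sup>2)) has_sum 1 / z\<^sup>2 * Eis_row z' n) UNIV"
      by (subst has_sum_reindex_bij_betw[where g = uminus and f = "\<lambda>m. 1 / z\<^sup>2 * (1 / (of_int n * z' + of_int m)\<^sup>2)"])
        (auto intro: bij_uminus)
    moreover have "1 / z\<^sup>2 * (1 / (of_int n * z' + of_int (- m))\<^sup>2) = 1 / (of_int m * z + of_int n)\<^sup>2" for m
    proof -
      have "z * (of_int n * z' + of_int (- m)) = - (of_int m * z + of_int n)"
        unfolding z'_def using z by (simp add: field_simps)
      then have "z\<^sup>2 * (of_int n * z' + of_int (- m))\<^sup>2 = (of_int m * z + of_int n)\<^sup>2"
        by (metis power2_minus power_mult_distrib)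
      then show ?thesis by (metis mult_1 times_divide_times_eq)
    qed
    ultimately have a: "((\<lambda>m. 1 / (of_int m * z + of_int n)\<^sup>2) has_sum 1 / z\<^sup>2 * Eis_row z' n) UNIV" by simp
    have dn: "(\<lambda>m. d (m, n)) summable_on UNIV"
      using summable_on_SigmaD1[of "\<lambda>n m. d (m, n)" UNIV "\<lambda>_. UNIV" n] T' by (auto simp: summable_on_def)
    define b where "b = (\<lambda>m::int. 1 / (of_int m * z + (of_int n - 1/2)) - 1 / (of_int m * z + (of_int (n + 1) - 1/2)))"
    have eq: "d (m, n) + 1 / (of_int m * z + of_int n)\<^sup>2 = b m" for m
      unfolding b_def d_def case_prod_conv b_eq[symmetric] by simp
    have "(\<lambda>m. d (m, n) + 1 / (of_int m * z + of_int n)\<^sup>2) summable_on UNIV"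
      using a by (intro summable_on_add dn) (auto simp: summable_on_def)
    then obtain B where B: "(b has_sum B) UNIV" unfolding eq by (auto simp: summable_on_def)
    have lim: "(\<lambda>N. \<Sum>m\<in>{- int N..int N}. 1 / (of_int m * z + (of_int n - 1/2))) \<longlonglongrightarrow> G n" for n
    proof -
      have "(\<lambda>N. 1 / z * (\<Sum>m\<in>{- int N..int N}. 1 / (of_int m + (of_int n - 1/2) / z))) \<longlonglongrightarrow>
          1 / z * (of_real pi * cot (of_real pi * ((of_int n - 1/2) / z)))"
        by (intro tendsto_intros cot_partial_fractions half_integer_multiple_notin_Ints assms)
      moreover have "1 / z * (1 / (of_int m + (of_int n - 1/2) / z)) = 1 / (of_int m * z + (of_int n - 1/2))" for m
        using z by (simp add: distrib_left mult.commute)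
      ultimately show ?thesis unfolding G_def sum_distrib_left by simp
    qed
    have "(\<lambda>N. \<Sum>m\<in>{- int N..int N}. b m) \<longlonglongrightarrow> G n - G (n + 1)"
      unfolding b_def sum_subtractf by (intro tendsto_diff lim)
    then have "B = G n - G (n + 1)"
      using has_sum_int_symmetric_LIMSEQ[OF B] LIMSEQ_unique by blast
    with has_sum_minus[OF B a] show "((\<lambda>m. case (n, m) of (n, m) \<Rightarrow> d (m, n)) has_sum
        (G n - G (n + 1)) - 1 / z\<^sup>2 * Eis_row z' n) UNIV"
      unfolding eq[symmetric] by simp
  qed
  from has_sum_add[OF this has_sum_cmult_right[OF has_sum_Eis_row[OF z'], of "1 / z\<^sup>2"]]
  have GT: "((\<lambda>n. G n - G (n + 1)) has_sum T + 1 / z\<^sup>2 * ((of_real pi)\<^sup>2 / 3 * E2 z')) UNIV"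
    by (simp only: diff_add_cancel)
  \<comment> \<open>Both ends contribute: the cotangent tends to i at one and, being odd, to -i at
    the other.\<close>
  have "(\<lambda>N. G (- int N) - G (int N + 1)) \<longlonglongrightarrow> - 2 * (of_real pi / z * \<i>)"
  proof -
    have "G (int N + 1) = of_real pi / z * cot (of_real pi * ((of_nat N + 1/2) / z))" for N
      unfolding G_def by (simp add: algebra_simps)
    moreover have "G (- int N) = - (of_real pi / z * cot (of_real pi * ((of_nat N + 1/2) / z)))" for N
    proof -
      have "of_real pi * ((of_int (- int N) - 1/2) / z) = - (of_real pi * ((of_nat N + 1/2) / z))"
      proof -
        have "of_int (- int N) - 1/2 = - (of_nat N + 1/2 :: complex)" by simp
        then show ?thesis by (simp only: minus_divide_left[symmetric] mult_minus_right)
      qed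
      then show ?thesis unfolding G_def by (simp only: cot_minus mult_minus_right)
    qed
    ultimately have "G (- int N) - G (int N + 1) = - 2 * (of_real pi / z * cot (of_real pi * ((of_nat N + 1/2) / z)))" for N
      by simp
    moreover have "(\<lambda>N. - 2 * (of_real pi / z * cot (of_real pi * ((of_nat N + 1/2) / z)))) \<longlonglongrightarrow> - 2 * (of_real pi / z * \<i>)"
      by (intro tendsto_intros cot_half_integer_LIMSEQ assms)
    ultimately show ?thesis by simp
  qed
  then have "((\<lambda>n. G n - G (n + 1)) has_sum - 2 * (of_real pi / z * \<i>)) UNIV"
    using GT by (intro has_sum_telescope) (auto simp: summable_on_def)
  from has_sum_unique[OF this GT]
  have "- 2 * (of_real pi / z * \<i>) = - ((of_real pi)\<^sup>2 / 3 * E2 z) + 1 / z\<^sup>2 * ((of_real pi)\<^sup>2 / 3 * E2 z')"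
    unfolding T1 .
  then have "3 * z\<^sup>2 / (of_real pi)\<^sup>2 * (- 2 * (of_real pi / z * \<i>)) =
      3 * z\<^sup>2 / (of_real pi)\<^sup>2 * (- ((of_real pi)\<^sup>2 / 3 * E2 z) + 1 / z\<^sup>2 * ((of_real pi)\<^sup>2 / 3 * E2 z'))"
    by (rule arg_cong)
  also have "\<dots> = - (z\<^sup>2 * E2 z) + E2 z'" using z by (simp add: field_simps)
  also have "3 * z\<^sup>2 / (of_real pi)\<^sup>2 * (- 2 * (of_real pi / z * \<i>)) = 6 * z / (of_real pi * \<i>)"
    using z by (simp add: field_simps power2_eq_square)
  finally show ?thesis unfolding z'_def by (simp add: algebra_simps)
qed

section \<open>Serre derivatives and behaviour at the cusp\<close>

lemma open_UHP: "open UHP"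
  unfolding UHP_def by (rule open_halfspace_Im_gt)

lemma convex_UHP: "convex UHP"
  unfolding UHP_def by (rule convex_halfspace_Im_gt)

lemma connected_UHP: "connected UHP"
  by (rule convex_connected[OF convex_UHP])

lemma i_in_UHP: "\<i> \<in> UHP"
  by (simp add: UHP_def)

lemma UHP_nonzero: "z \<in> UHP \<Longrightarrow> z \<noteq> 0"
  by (auto simp: UHP_def)

lemma UHP_S: "z \<in> UHP \<Longrightarrow> - 1 / z \<in> UHP"
  by (auto simp: UHP_def Im_divide intro!: divide_pos_pos add_nonneg_pos)

lemma UHP_T: "z + 1 \<in> UHP \<longleftrightarrow> z \<in> UHP"
  by (simp add: UHP_def)

lemma UHP_not_nonpos_Reals: "z \<in> UHP \<Longrightarrow> z \<notin> \<real>\<^sub>\<le>\<^sub>0"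
  by (auto simp: UHP_def complex_nonpos_Reals_iff)

lemma DERIV_in_UHP:
  "f holomorphic_on UHP \<Longrightarrow> z \<in> UHP \<Longrightarrow> (f has_field_derivative deriv f z) (at z)"
  using holomorphic_derivI[OF _ open_UHP] by blast

lemma deriv_cong_UHP:
  assumes "\<And>w. w \<in> UHP \<Longrightarrow> f w = g w" "z \<in> UHP"
  shows "deriv f z = deriv g z"
proof (rule deriv_cong_ev)
  show "\<forall>\<^sub>F w in nhds z. f w = g w"
    using eventually_nhds_in_open[OF open_UHP assms(2)] by eventually_elim (rule assms(1))
qed simp

section \<open>A logarithm of eta and its transformation laws\<close>

definition q1 :: "complex \<Rightarrow> complex" where
  "q1 z = exp (2 * of_real pi * \<i> * z)"

lemma q1_T: "q1 (z + 1) = q1 z"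
  unfolding q1_def by (simp add: distrib_left exp_add)

lemma norm_q1_less_1: "z \<in> UHP \<Longrightarrow> norm (q1 z) < 1"
  unfolding q1_def by (rule norm_exp_2pi_less_1)

lemma DERIV_q1: "(q1 has_field_derivative 2 * of_real pi * \<i> * q1 z) (at z)"
  unfolding q1_def by (auto intro!: derivative_eq_intros)

lemma sigma1_le: "sigma1 n \<le> n * n"
proof (cases "n = 0")
  case False
  have "sigma1 n \<le> (\<Sum>d | d dvd n. n)"
    unfolding sigma1_def using False by (intro sum_mono) (auto dest: dvd_imp_le)
  also have "\<dots> = card {d. d dvd n} * n" by simp
  also have "card {d. d dvd n} \<le> card {1..n}"
    using False by (intro card_mono) (auto dest: dvd_imp_le intro: Suc_leI dvd_pos_nat)
  finally show ?thesis by simp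
qed (simp add: sigma1_def)

text \<open>The power series with these coefficients is minus the logarithm of the product of 1 -
  x^n over n \<ge> 1: for n > 0 the coefficient is the sum of 1/d over the divisors d of n. At n = 0
  it is 0/0 = 0.\<close>

definition eta_coeff :: "nat \<Rightarrow> complex" where
  "eta_coeff n = of_nat (sigma1 n) / of_nat n"

definition eta_series :: "complex \<Rightarrow> complex" where
  "eta_series x = (\<Sum>n. eta_coeff n * x ^ n)"

lemma summable_eta_coeff:
  assumes "norm x < 1"
  shows "summable (\<lambda>n. eta_coeff n * x ^ n)"
proof (rule summable_comparison_test')
  show "summable (\<lambda>n. of_nat (Suc n) * norm x ^ n)"
    using geometric_deriv_sums[of "norm x"] assms by (simp add: sums_iff)
  show "norm (eta_coeff n * x ^ n) \<le> of_nat (Suc n) * norm x ^ n" for n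
  proof -
    have "real (sigma1 n) \<le> real (n * n)" using sigma1_le[of n] by (simp only: of_nat_le_iff)
    then have "norm (eta_coeff n) \<le> real n"
      unfolding eta_coeff_def by (cases "n = 0") (simp_all add: norm_divide divide_simps)
    then show ?thesis unfolding norm_mult norm_power
      by (intro mult_right_mono) auto
  qed
qed

lemma diffs_eta_coeff: "diffs eta_coeff n = of_nat (sigma1 (Suc n))"
  unfolding diffs_def eta_coeff_def by (simp del: of_nat_Suc)

lemma DERIV_eta_series:
  assumes "norm x < 1"
  shows "(eta_series has_field_derivative (\<Sum>n. of_nat (sigma1 (Suc n)) * x ^ n)) (at x)"
  unfolding eta_series_def[abs_def] diffs_eta_coeff[symmetric]
  by (rule termdiffs_strong'[where K = 1]) (use assms summable_eta_coeff in auto)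

lemma eta_series_holomorphic: "eta_series holomorphic_on ball 0 1"
  unfolding holomorphic_on_open[OF open_ball] using DERIV_eta_series by fastforce

lemma E2_eq_deriv_eta_series:
  assumes "z \<in> UHP"
  shows "E2 z = 1 - 24 * (q1 z * deriv eta_series (q1 z))"
proof -
  let ?q = "q1 z"
  have q: "norm ?q < 1" by (rule norm_q1_less_1[OF assms])
  have d: "deriv eta_series ?q = (\<Sum>n. of_nat (sigma1 (Suc n)) * ?q ^ n)"
    by (rule DERIV_imp_deriv[OF DERIV_eta_series[OF q]])
  have "summable (\<lambda>n. diffs eta_coeff n * ?q ^ n)"
    by (rule termdiff_converges[OF q summable_eta_coeff])
  then have "(\<Sum>n. ?q * (diffs eta_coeff n * ?q ^ n)) = ?q * (\<Sum>n. diffs eta_coeff n * ?q ^ n)"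
    by (rule suminf_mult)
  then show ?thesis
    unfolding E2_def qpow_of_nat q1_def[symmetric] d diffs_eta_coeff by (simp add: mult_ac)
qed

text \<open>A logarithm of \<open>\<eta>\<^sup>2\<close>, so \<open>exp (12 * ln_eta2 z)\<close> is the discriminant; it provides real powers of
  \<open>\<eta>\<close> without any choice of branch.\<close>
definition ln_eta2 :: "complex \<Rightarrow> complex" where
  "ln_eta2 z = 2 * of_real pi * \<i> / 12 * z - 2 * eta_series (q1 z)"

lemma DERIV_ln_eta2:
  assumes "z \<in> UHP"
  shows "(ln_eta2 has_field_derivative 2 * of_real pi * \<i> / 12 * E2 z) (at z)"
proof -
  have "(eta_series has_field_derivative deriv eta_series (q1 z)) (at (q1 z))"
    using norm_q1_less_1[OF assms] by (intro holomorphic_derivI[OF eta_series_holomorphic]) auto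
  from DERIV_chain2[OF this DERIV_q1]
  show ?thesis
    unfolding ln_eta2_def[abs_def] E2_eq_deriv_eta_series[OF assms]
    by (auto intro!: derivative_eq_intros simp: algebra_simps)
qed

lemma ln_eta2_holomorphic: "ln_eta2 holomorphic_on UHP"
  using DERIV_ln_eta2 by (subst holomorphic_on_open[OF open_UHP]) blast

lemma E2_holomorphic: "E2 holomorphic_on UHP"
proof (rule holomorphic_transform)
  show "(\<lambda>z. 12 / (2 * of_real pi * \<i>) * deriv ln_eta2 z) holomorphic_on UHP"
    by (intro holomorphic_intros holomorphic_deriv ln_eta2_holomorphic open_UHP)
  show "12 / (2 * of_real pi * \<i>) * deriv ln_eta2 z = E2 z" if "z \<in> UHP" for z
    unfolding DERIV_imp_deriv[OF DERIV_ln_eta2[OF that]] by simp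
qed

lemma E2_T: "E2 (z + 1) = E2 z"
  unfolding E2_def qpow_of_nat q1_def[symmetric] q1_T ..

lemma ln_eta2_T: "ln_eta2 (z + 1) = ln_eta2 z + 2 * of_real pi * \<i> / 12"
  unfolding ln_eta2_def q1_T by (simp add: algebra_simps)

lemma DERIV_S:
  assumes "f holomorphic_on UHP" "z \<in> UHP"
  shows "((\<lambda>z. f (- 1 / z)) has_field_derivative deriv f (- 1 / z) / z\<^sup>2) (at z)"
proof -
  have "((\<lambda>z. - 1 / z) has_field_derivative 1 / z\<^sup>2) (at z)"
    using UHP_nonzero[OF assms(2)] by (auto intro!: derivative_eq_intros simp: power2_eq_square)
  from DERIV_chain2[OF DERIV_in_UHP[OF assms(1) UHP_S[OF assms(2)]] this] show ?thesis by simp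
qed

text \<open>Both sides have the same derivative: the inhomogeneous term of \<open>E2_S\<close>
  becomes 1/z, the derivative of the principal logarithm, whose cut misses the upper half plane. The
  constant is found at the fixed point i, where Ln i = i pi / 2.\<close>

lemma ln_eta2_S:
  assumes "z \<in> UHP"
  shows "ln_eta2 (- 1 / z) = ln_eta2 z + Ln z - \<i> * of_real pi / 2"
proof -
  have "\<exists>c. \<forall>z\<in>UHP. ln_eta2 (- 1 / z) - ln_eta2 z - Ln z = c"
  proof (rule has_field_derivative_zero_constant[OF convex_UHP])
    fix z assume z: "z \<in> UHP"
    have nz: "z \<noteq> 0" by (rule UHP_nonzero[OF z])
    have "deriv ln_eta2 (- 1 / z) = 2 * of_real pi * \<i> / 12 * E2 (- 1 / z)"
      by (rule DERIV_imp_deriv[OF DERIV_ln_eta2[OF UHP_S[OF z]]])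
    also have "\<dots> = 2 * of_real pi * \<i> / 12 * E2 z * z\<^sup>2 + z"
    proof -
      have "2 * of_real pi * \<i> / 12 * (6 * z / (of_real pi * \<i>)) = z" by simp
      then show ?thesis unfolding E2_S[OF z] distrib_left by (simp add: mult_ac)
    qed
    finally have e: "deriv ln_eta2 (- 1 / z) / z\<^sup>2 - 2 * of_real pi * \<i> / 12 * E2 z - inverse z = 0"
      using nz by (simp add: field_simps power2_eq_square)
    show "((\<lambda>z. ln_eta2 (- 1 / z) - ln_eta2 z - Ln z) has_field_derivative 0) (at z within UHP)"
      unfolding e[symmetric]
      by (rule has_field_derivative_at_within,
          rule DERIV_diff[OF DERIV_diff[OF DERIV_S[OF ln_eta2_holomorphic z] DERIV_ln_eta2[OF z]]
            has_field_derivative_Ln[OF UHP_not_nonpos_Reals[OF z]]])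
  qed
  then obtain c where "\<And>z. z \<in> UHP \<Longrightarrow> ln_eta2 (- 1 / z) - ln_eta2 z - Ln z = c" by blast
  then have c: "ln_eta2 (- 1 / z) = ln_eta2 z + Ln z + c" if "z \<in> UHP" for z
    using that by (metis add.commute diff_diff_add diff_add_cancel)
  have "- 1 / \<i> = \<i>" by simp
  then have "c = - (\<i> * of_real pi / 2)"
    using c[OF i_in_UHP] by (simp add: add_eq_0_iff)
  then show ?thesis using c[OF assms] by simp
qed

text \<open>Limits along this filter are uniform in the real part. Limits on vertical lines would
  not support the Cauchy estimate on discs or the maximum argument on a strip.\<close>

abbreviation at_cusp :: "complex filter" where
  "at_cusp \<equiv> filtercomap Im at_top"

lemma eventually_at_cusp: "(\<forall>\<^sub>F z in at_cusp. P z) \<longleftrightarrow> (\<exists>Y>0. \<forall>z. Im z > Y \<longrightarrow> P z)"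
proof -
  have "(\<forall>\<^sub>F z in at_cusp. P z) \<longleftrightarrow> (\<exists>Y. \<forall>z. Im z > Y \<longrightarrow> P z)"
    unfolding eventually_filtercomap_at_top_dense ..
  also have "\<dots> \<longleftrightarrow> (\<exists>Y>0. \<forall>z. Im z > Y \<longrightarrow> P z)"
  proof
    assume "\<exists>Y. \<forall>z. Im z > Y \<longrightarrow> P z"
    then obtain Y where "\<forall>z. Im z > Y \<longrightarrow> P z" ..
    then show "\<exists>Y>0. \<forall>z. Im z > Y \<longrightarrow> P z" by (intro exI[of _ "max Y 1"]) auto
  qed blast
  finally show ?thesis .
qed

lemma eventually_at_cusp_UHP: "\<forall>\<^sub>F z in at_cusp. z \<in> UHP"
  unfolding eventually_at_cusp UHP_def by (auto intro: exI[of _ 1])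

lemma at_cusp_neq_bot: "at_cusp \<noteq> bot"
proof
  assume "at_cusp = bot"
  then have "\<forall>\<^sub>F z in at_cusp. False" by simp
  then obtain Y where "\<forall>z. \<not> Im z > Y" unfolding eventually_at_cusp by blast
  then have "\<not> Im (Complex 0 (Y + 1)) > Y" by blast
  then show False by simp
qed

lemma tendsto_at_cusp_cong:
  assumes "(f \<longlongrightarrow> l) at_cusp" "\<And>z. z \<in> UHP \<Longrightarrow> f z = g z"
  shows "(g \<longlongrightarrow> l) at_cusp"
  using assms(1) by (rule Lim_transform_eventually)
    (use eventually_at_cusp_UHP in eventually_elim, use assms(2) in blast)

section \<open>Exponents at the cusp\<close>

lemma norm_qpow: "norm (qpow r z) = exp (- 2 * pi * r * Im z)"
  unfolding qpow_def by simp

lemma tendsto_qpow_at_cusp: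
  assumes "r > 0"
  shows "(qpow r \<longlongrightarrow> 0) at_cusp"
proof -
  have "((\<lambda>y. exp (- 2 * pi * r * y)) \<longlongrightarrow> 0) at_top"
  proof -
    have "filterlim (\<lambda>y. - 2 * pi * r * y) at_bot at_top"
      using assms by (intro filterlim_tendsto_neg_mult_at_bot[OF tendsto_const _ filterlim_ident]) auto
    then show ?thesis by (rule filterlim_compose[OF exp_at_bot])
  qed
  then have "((\<lambda>z. exp (- 2 * pi * r * Im z)) \<longlongrightarrow> 0) at_cusp"
    by (rule filterlim_compose[OF _ filterlim_filtercomap])
  then show ?thesis unfolding norm_qpow[symmetric] by (rule tendsto_norm_zero_cancel)
qed

lemma qpow_add: "qpow (r + s) z = qpow r z * qpow s z"
  unfolding qpow_def exp_add[symmetric] by (simp add: algebra_simps)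

lemma qpow_0 [simp]: "qpow 0 z = 1"
  unfolding qpow_def by simp

lemma qpow_nonzero [simp]: "qpow r z \<noteq> 0"
  unfolding qpow_def by simp

lemma qpow_minus: "qpow (- r) z = inverse (qpow r z)"
  unfolding qpow_def by (simp add: exp_minus)

lemma DERIV_qpow: "(qpow r has_field_derivative 2 * of_real pi * \<i> * of_real r * qpow r z) (at z)"
  unfolding qpow_def[abs_def] by (auto intro!: derivative_eq_intros)

lemma qpow_holomorphic [holomorphic_intros]: "qpow r holomorphic_on A"
  unfolding qpow_def[abs_def] by (intro holomorphic_intros)

lemma q1_eq_qpow: "q1 = qpow 1"
  unfolding q1_def[abs_def] qpow_def[abs_def] by simp

lemma tendsto_q1_at_cusp: "(q1 \<longlongrightarrow> 0) at_cusp"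
  unfolding q1_eq_qpow by (rule tendsto_qpow_at_cusp) simp

lemma tendsto_E2_at_cusp: "(E2 \<longlongrightarrow> 1) at_cusp"
proof -
  have "isCont (deriv eta_series) 0"
    using holomorphic_deriv[OF eta_series_holomorphic open_ball]
    by (intro continuous_on_interior[OF holomorphic_on_imp_continuous_on]) auto
  then have "((\<lambda>z. deriv eta_series (q1 z)) \<longlongrightarrow> deriv eta_series 0) at_cusp"
    by (rule isCont_tendsto_compose[OF _ tendsto_q1_at_cusp])
  then have "((\<lambda>z. 1 - 24 * (q1 z * deriv eta_series (q1 z))) \<longlongrightarrow> 1 - 24 * (0 * deriv eta_series 0)) at_cusp"
    by (intro tendsto_intros tendsto_q1_at_cusp)
  then have "((\<lambda>z. 1 - 24 * (q1 z * deriv eta_series (q1 z))) \<longlongrightarrow> 1) at_cusp" by simp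
  then show ?thesis by (rule tendsto_at_cusp_cong) (simp add: E2_eq_deriv_eta_series)
qed

text \<open>exp(w * \<open>ln_eta2\<close>) is eta^(2 w) and has exponent w/12: the linear part of
  \<open>ln_eta2\<close> cancels against the power of q, and \<open>eta_series\<close> vanishes at
  0.\<close>

lemma tendsto_exp_ln_eta2_at_cusp:
  "((\<lambda>z. exp (of_real w * ln_eta2 z) * qpow (- w / 12) z) \<longlongrightarrow> 1) at_cusp"
proof -
  have "isCont eta_series 0"
    by (intro continuous_on_interior[OF holomorphic_on_imp_continuous_on[OF eta_series_holomorphic]]) auto
  then have "((\<lambda>z. eta_series (q1 z)) \<longlongrightarrow> eta_series 0) at_cusp"
    by (rule isCont_tendsto_compose[OF _ tendsto_q1_at_cusp])
  moreover have "eta_series 0 = 0" unfolding eta_series_def powser_zero by (simp add: eta_coeff_def)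
  ultimately have "((\<lambda>z. exp (- 2 * of_real w * eta_series (q1 z))) \<longlongrightarrow> exp (- 2 * of_real w * 0)) at_cusp"
    by (intro tendsto_intros) simp
  moreover have "exp (- 2 * of_real w * eta_series (q1 z)) = exp (of_real w * ln_eta2 z) * qpow (- w / 12) z" for z
    unfolding qpow_def exp_add[symmetric] ln_eta2_def
    by (rule arg_cong[where f = exp]) (simp add: algebra_simps)
  ultimately show ?thesis by simp
qed

text \<open>Cauchy's inequality on discs of radius 1, on which f - c is uniformly small once the
  centre is high enough.\<close>

lemma tendsto_deriv_at_cusp:
  assumes hol: "f holomorphic_on UHP" and lim: "(f \<longlongrightarrow> c) at_cusp"
  shows "(deriv f \<longlongrightarrow> 0) at_cusp"
proof (rule tendstoI)
  fix e :: real assume e: "e > 0"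
  have "\<forall>\<^sub>F z in at_cusp. dist (f z) c < e / 2" using lim e by (intro tendstoD) auto
  then obtain Y where Y: "Y > 0" "\<And>z. Im z > Y \<Longrightarrow> dist (f z) c < e / 2"
    unfolding eventually_at_cusp by blast
  show "\<forall>\<^sub>F z in at_cusp. dist (deriv f z) 0 < e"
    unfolding eventually_at_cusp
  proof (intro exI[of _ "Y + 1"] conjI allI impI)
    fix z assume z: "Im z > Y + 1"
    have im: "Im w > Y" if "w \<in> cball z 1" for w
      using abs_Im_le_cmod[of "z - w"] that z by (auto simp: dist_norm)
    have sub: "cball z 1 \<subseteq> UHP" using im Y(1) by (force simp: UHP_def)
    define g where "g = (\<lambda>w. f w - c)"
    have g: "g holomorphic_on cball z 1"
      unfolding g_def by (intro holomorphic_intros holomorphic_on_subset[OF hol sub])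
    have "norm ((deriv ^^ 1) g z) \<le> fact 1 * (e / 2) / 1 ^ 1"
    proof (rule Cauchy_inequality)
      show "g holomorphic_on ball z 1" by (rule holomorphic_on_subset[OF g]) auto
      show "continuous_on (cball z 1) g" by (rule holomorphic_on_imp_continuous_on[OF g])
      show "norm (g x) \<le> e / 2" if "norm (z - x) = 1" for x
        using Y(2)[OF im[of x]] that by (simp add: g_def dist_norm)
    qed simp
    moreover have "deriv g z = deriv f z"
    proof (rule DERIV_imp_deriv)
      have "z \<in> UHP" using sub by auto
      then show "(g has_field_derivative deriv f z) (at z)"
        unfolding g_def using DERIV_in_UHP[OF hol] by (auto intro!: derivative_eq_intros)
    qed
    ultimately show "dist (deriv f z) 0 < e" using e by simp
  qed (use Y in simp)
qed

section \<open>Serre derivatives: linearity, covariance, leading terms\<close>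

lemma Dop_holomorphic:
  assumes "f holomorphic_on UHP"
  shows "Dop k f holomorphic_on UHP"
  unfolding Dop_def[abs_def]
  by (intro holomorphic_intros holomorphic_deriv assms open_UHP E2_holomorphic) simp

lemma Diter_holomorphic:
  assumes "f holomorphic_on UHP"
  shows "Diter k j f holomorphic_on UHP"
  by (induction j) (simp_all add: assms Dop_holomorphic)

lemma Dop_cong:
  assumes "\<And>w. w \<in> UHP \<Longrightarrow> f w = g w" "z \<in> UHP"
  shows "Dop k f z = Dop k g z"
  unfolding Dop_def using deriv_cong_UHP[OF assms] assms by simp

lemma Dop_sum:
  assumes "\<And>i. i \<in> I \<Longrightarrow> f i holomorphic_on UHP" "z \<in> UHP"
  shows "Dop k (\<lambda>z. \<Sum>i\<in>I. c i * f i z) z = (\<Sum>i\<in>I. c i * Dop k (f i) z)"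
proof -
  have "((\<lambda>z. \<Sum>i\<in>I. c i * f i z) has_field_derivative (\<Sum>i\<in>I. c i * deriv (f i) z)) (at z)"
    by (intro DERIV_sum DERIV_cmult DERIV_in_UHP assms)
  then have "deriv (\<lambda>z. \<Sum>i\<in>I. c i * f i z) z = (\<Sum>i\<in>I. c i * deriv (f i) z)"
    by (rule DERIV_imp_deriv)
  then show ?thesis unfolding Dop_def
    by (simp add: sum_divide_distrib sum_distrib_left right_diff_distrib sum_subtractf mult_ac)
qed

lemma Diter_sum:
  assumes "\<And>i. i \<in> I \<Longrightarrow> f i holomorphic_on UHP" "z \<in> UHP"
  shows "Diter k j (\<lambda>z. \<Sum>i\<in>I. c i * f i z) z = (\<Sum>i\<in>I. c i * Diter k j (f i) z)"
  using assms(2)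
proof (induction j arbitrary: z)
  case (Suc j)
  have "Dop (k + 2 * real j) (Diter k j (\<lambda>z. \<Sum>i\<in>I. c i * f i z)) z =
     Dop (k + 2 * real j) (\<lambda>z. \<Sum>i\<in>I. c i * Diter k j (f i) z) z"
    by (rule Dop_cong) (use Suc in auto)
  also have "\<dots> = (\<Sum>i\<in>I. c i * Dop (k + 2 * real j) (Diter k j (f i)) z)"
    by (rule Dop_sum) (auto intro: Diter_holomorphic assms(1) Suc.prems)
  finally show ?case by simp
qed simp

lemma Dop_T:
  assumes "\<And>z. z \<in> UHP \<Longrightarrow> f (z + 1) = g z" "f holomorphic_on UHP" "z \<in> UHP"
  shows "Dop k f (z + 1) = Dop k g z"
proof -
  have "((\<lambda>z. f (z + 1)) has_field_derivative deriv f (z + 1) * 1) (at z)"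
    using assms by (intro DERIV_chain2[OF DERIV_in_UHP[OF assms(2)]]) (auto simp: UHP_T intro!: derivative_eq_intros)
  then have "deriv (\<lambda>z. f (z + 1)) z = deriv f (z + 1)" using DERIV_imp_deriv by fastforce
  moreover have "deriv (\<lambda>z. f (z + 1)) z = deriv g z"
    by (rule deriv_cong_UHP[OF assms(1,3)])
  ultimately show ?thesis unfolding Dop_def E2_T using assms by simp
qed

lemma Diter_T:
  assumes "\<And>z. z \<in> UHP \<Longrightarrow> f (z + 1) = g z" "f holomorphic_on UHP" "z \<in> UHP"
  shows "Diter k j f (z + 1) = Diter k j g z"
  using assms(3)
  by (induction j arbitrary: z) (auto intro!: Dop_T Diter_holomorphic assms)

text \<open>Differentiating z^k produces an extra term k z^(k+1) g / (2 pi i), which the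
  inhomogeneous part of \<open>E2_S\<close>, multiplied by k/12, cancels. Two functions f and g
  occur because inversion mixes the components of a vector-valued form.\<close>

lemma Dop_S:
  assumes "\<And>z. z \<in> UHP \<Longrightarrow> f (- 1 / z) = z powr of_real k * g z"
    and f: "f holomorphic_on UHP" and g: "g holomorphic_on UHP" and z: "z \<in> UHP"
  shows "Dop k f (- 1 / z) = z powr of_real k * z\<^sup>2 * Dop k g z"
proof -
  have nz: "z \<noteq> 0" by (rule UHP_nonzero[OF z])
  let ?p = "z powr of_real k"
  have "((\<lambda>z. z powr of_real k * g z) has_field_derivative
      of_real k * (?p / z) * g z + ?p * deriv g z) (at z)"
  proof -
    have "((\<lambda>z. z powr of_real k) has_field_derivative of_real k * (?p / z)) (at z)"
      using has_field_derivative_powr[OF UHP_not_nonpos_Reals[OF z], of "of_real k"] nz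
      by (simp add: powr_diff)
    from DERIV_mult[OF this DERIV_in_UHP[OF g z]] show ?thesis by (simp add: mult_ac)
  qed
  then have "deriv (\<lambda>z. z powr of_real k * g z) z = of_real k * (?p / z) * g z + ?p * deriv g z"
    by (rule DERIV_imp_deriv)
  moreover have "deriv (\<lambda>z. f (- 1 / z)) z = deriv f (- 1 / z) / z\<^sup>2"
    by (rule DERIV_imp_deriv[OF DERIV_S[OF f z]])
  moreover have "deriv (\<lambda>z. f (- 1 / z)) z = deriv (\<lambda>z. z powr of_real k * g z) z"
    by (rule deriv_cong_UHP[OF assms(1) z])
  ultimately have "deriv f (- 1 / z) / z\<^sup>2 = of_real k * (?p / z) * g z + ?p * deriv g z"
    by simp
  then have d: "deriv f (- 1 / z) = ?p * (of_real k * z * g z + z\<^sup>2 * deriv g z)"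
    using nz by (simp add: field_simps power2_eq_square)
  show ?thesis unfolding Dop_def d E2_S[OF z] assms(1)[OF z]
    by (simp add: field_simps)
qed

lemma powr_add_of_nat:
  assumes "z \<noteq> (0::complex)"
  shows "z powr (a + of_nat n) = z powr a * z ^ n"
proof -
  have "exp (of_nat n * Ln z) = z ^ n" unfolding exp_of_nat_mult using assms by simp
  then show ?thesis using assms by (simp add: powr_def distrib_right exp_add)
qed

lemma Diter_S:
  assumes "\<And>z. z \<in> UHP \<Longrightarrow> f (- 1 / z) = z powr of_real k * g z"
    and f: "f holomorphic_on UHP" and g: "g holomorphic_on UHP" and z: "z \<in> UHP"
  shows "Diter k j f (- 1 / z) = z powr of_real k * z ^ (2 * j) * Diter k j g z"
  using z
proof (induction j arbitrary: z)
  case 0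
  then show ?case using assms(1)[OF 0] by simp
next
  case (Suc j)
  have p: "w powr of_real (k + 2 * real j) = w powr of_real k * w ^ (2 * j)" if "w \<in> UHP" for w
    using powr_add_of_nat[OF UHP_nonzero[OF that], of "of_real k" "2 * j"] by simp
  have "Dop (k + 2 * real j) (Diter k j f) (- 1 / z) =
     z powr of_real (k + 2 * real j) * z\<^sup>2 * Dop (k + 2 * real j) (Diter k j g) z"
    by (rule Dop_S) (use Suc p in \<open>auto intro: Diter_holomorphic f g\<close>)
  then show ?case using p[OF Suc.prems] by (simp add: power2_eq_square mult_ac)
qed

text \<open>Divided by q^r the function converges at the cusp, so its derivative tends to 0; there
  remain r from differentiating q^r and -k/12 from the constant term of \<open>E2\<close>.\<close>

lemma tendsto_Dop_at_cusp:
  assumes f: "f holomorphic_on UHP" and lim: "((\<lambda>z. qpow (- r) z * f z) \<longlongrightarrow> c) at_cusp"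
  shows "((\<lambda>z. qpow (- r) z * Dop k f z) \<longlongrightarrow> of_real (r - k / 12) * c) at_cusp"
proof -
  define h where "h = (\<lambda>z. qpow (- r) z * f z)"
  have h: "h holomorphic_on UHP" unfolding h_def by (intro holomorphic_intros f)
  have eq: "of_real r * h z + deriv h z / (2 * of_real pi * \<i>) - of_real k / 12 * (E2 z * h z) =
      qpow (- r) z * Dop k f z" if z: "z \<in> UHP" for z
  proof -
    have "(h has_field_derivative 2 * of_real pi * \<i> * of_real (- r) * qpow (- r) z * f z +
        qpow (- r) z * deriv f z) (at z)"
      unfolding h_def using DERIV_mult[OF DERIV_qpow[of "- r"] DERIV_in_UHP[OF f z]]
      by (simp add: algebra_simps)
    from DERIV_imp_deriv[OF this]
    have "deriv h z = - (2 * of_real pi * \<i> * of_real r * h z) + qpow (- r) z * deriv f z"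
      by (simp add: h_def)
    then show ?thesis unfolding Dop_def by (simp add: h_def field_simps)
  qed
  have "((\<lambda>z. of_real r * h z + deriv h z / (2 * of_real pi * \<i>) - of_real k / 12 * (E2 z * h z))
     \<longlongrightarrow> of_real r * c + 0 / (2 * of_real pi * \<i>) - of_real k / 12 * (1 * c)) at_cusp"
    using lim unfolding h_def[symmetric]
    by (intro tendsto_intros tendsto_E2_at_cusp tendsto_deriv_at_cusp[OF h]) auto
  then have "((\<lambda>z. qpow (- r) z * Dop k f z)
     \<longlongrightarrow> of_real r * c + 0 / (2 * of_real pi * \<i>) - of_real k / 12 * (1 * c)) at_cusp"
    by (rule tendsto_at_cusp_cong) (rule eq)
  then show ?thesis by (simp add: algebra_simps)
qed

text \<open>The value at r is the factor that the j-fold Serre derivative puts on the leading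
  coefficient of a function with exponent r.\<close>

definition indicial :: "real \<Rightarrow> nat \<Rightarrow> complex poly" where
  "indicial k j = (\<Prod>s<j. [:- of_real ((k + 2 * real s) / 12), 1:])"

lemma tendsto_Diter_at_cusp:
  assumes f: "f holomorphic_on UHP" and lim: "((\<lambda>z. qpow (- r) z * f z) \<longlongrightarrow> c) at_cusp"
  shows "((\<lambda>z. qpow (- r) z * Diter k j f z) \<longlongrightarrow> poly (indicial k j) (of_real r) * c) at_cusp"
proof (induction j)
  case 0
  then show ?case using lim by (simp add: indicial_def)
next
  case (Suc j)
  show ?case
    using tendsto_Dop_at_cusp[OF Diter_holomorphic[OF f] Suc, of "k + 2 * real j"]
    by (simp add: indicial_def algebra_simps)
qed

section \<open>Invariant functions and modular forms of level one\<close>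

lemma invariant_translate:
  fixes f :: "complex \<Rightarrow> 'a"
  assumes T: "\<And>z. z \<in> UHP \<Longrightarrow> f (z + 1) = f z" and z: "z \<in> UHP"
  shows "f (z + of_int n) = f z"
proof -
  have nat: "f (w + of_nat k) = f w" if "w \<in> UHP" for w and k :: nat
  proof (induction k)
    case (Suc k)
    have "w + of_nat k \<in> UHP" using that by (simp add: UHP_def)
    then have "f (w + of_nat k + 1) = f (w + of_nat k)" by (rule T)
    then show ?case using Suc by (simp add: add_ac)
  qed simp
  show ?thesis
  proof (cases "n \<ge> 0")
    case True
    then show ?thesis using nat[OF z, of "nat n"] by simp
  next
    case False
    have "z + of_int n \<in> UHP" using z by (simp add: UHP_def)
    from nat[OF this, of "nat (- n)"] False show ?thesis by simp
  qed
qed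

text \<open>A substitute for the fundamental domain; height at least 1/2 is enough for compactness.
  If |Re w| \<le> 1/2 and Im w \<le> 1/2, then |w|^2 \<le> 1/2, so inversion at least doubles the
  height. Hence the induction on the bound 1/2^n.\<close>

lemma invariant_reduction:
  fixes f :: "complex \<Rightarrow> 'a"
  assumes T: "\<And>z. z \<in> UHP \<Longrightarrow> f (z + 1) = f z"
    and S: "\<And>z. z \<in> UHP \<Longrightarrow> f (- 1 / z) = f z"
    and z: "z \<in> UHP"
  shows "\<exists>w. \<bar>Re w\<bar> \<le> 1/2 \<and> Im w \<ge> 1/2 \<and> f w = f z"
proof -
  have "\<exists>w. \<bar>Re w\<bar> \<le> 1/2 \<and> Im w \<ge> 1/2 \<and> f w = f z" if "z \<in> UHP" "Im z \<ge> 1 / 2 ^ n" for n z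
    using that
  proof (induction n arbitrary: z)
    case (0 z)
    let ?w = "z + of_int (- round (Re z))"
    have "\<bar>Re ?w\<bar> \<le> 1/2" using of_int_round_abs_le[of "Re z"] by (simp add: abs_minus_commute)
    moreover have "f ?w = f z" by (rule invariant_translate[of f, OF T 0(1)])
    ultimately show ?case using 0 by (intro exI[of _ ?w]) simp
  next
    case (Suc n z)
    let ?w = "z + of_int (- round (Re z))"
    have re: "\<bar>Re ?w\<bar> \<le> 1/2" using of_int_round_abs_le[of "Re z"] by (simp add: abs_minus_commute)
    have f: "f ?w = f z" by (rule invariant_translate[of f, OF T Suc(2)])
    have w: "?w \<in> UHP" using Suc(2) by (simp add: UHP_def)
    show ?case
    proof (cases "Im z \<ge> 1/2")
      case True
      then show ?thesis using re f by (intro exI[of _ ?w]) simp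
    next
      case False
      have im: "0 < Im ?w" "Im ?w \<le> 1/2" using False Suc(2) by (auto simp: UHP_def)
      have "(Re ?w)\<^sup>2 \<le> (1/2)\<^sup>2" using re by (metis abs_ge_zero power2_abs power_mono)
      moreover have "(Im ?w)\<^sup>2 \<le> (1/2)\<^sup>2" using im by (intro power_mono) auto
      ultimately have n: "(Re ?w)\<^sup>2 + (Im ?w)\<^sup>2 \<le> 1/2" by (simp add: power2_eq_square)
      have p: "(Re ?w)\<^sup>2 + (Im ?w)\<^sup>2 > 0" using im by (simp add: add_nonneg_pos)
      have "1 / 2 ^ n \<le> 2 * Im ?w" using Suc(3) by simp
      also have "2 * Im ?w \<le> Im (- 1 / ?w)"
      proof -
        have "Im ?w / (1/2) \<le> Im ?w / ((Re ?w)\<^sup>2 + (Im ?w)\<^sup>2)"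
          using n p im by (intro divide_left_mono) auto
        then show ?thesis by (simp add: Im_divide)
      qed
      finally have "\<exists>v. \<bar>Re v\<bar> \<le> 1/2 \<and> Im v \<ge> 1/2 \<and> f v = f (- 1 / ?w)"
        by (rule Suc(1)[OF UHP_S[OF w]])
      then show ?thesis using S[OF w] f by simp
    qed
  qed
  moreover have "\<exists>n. Im z \<ge> 1 / 2 ^ n"
  proof -
    have "Im z > 0" using z by (simp add: UHP_def)
    then obtain n where "(1/2) ^ n < Im z" using real_arch_pow_inv[of "Im z" "1/2"] by auto
    then show ?thesis by (intro exI[of _ n]) (simp add: power_one_over)
  qed
  ultimately show ?thesis using z by blast
qed

text \<open>If f z differs from c, then near the cusp |f - c| stays below |f z - c|, and by
  \<open>invariant_reduction\<close> all larger values are attained on a compact box. So |f - c| has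
  a maximum, f - c is constant, and its limit at the cusp is 0.\<close>

lemma invariant_holomorphic_constant:
  assumes hol: "f holomorphic_on UHP"
    and T: "\<And>z. z \<in> UHP \<Longrightarrow> f (z + 1) = f z"
    and S: "\<And>z. z \<in> UHP \<Longrightarrow> f (- 1 / z) = f z"
    and lim: "(f \<longlongrightarrow> c) at_cusp"
    and z: "z \<in> UHP"
  shows "f z = c"
proof (rule ccontr)
  assume ne: "f z \<noteq> c"
  define g where "g = (\<lambda>z. f z - c)"
  have g: "g holomorphic_on UHP" unfolding g_def by (intro holomorphic_intros hol)
  have gT: "g (w + 1) = g w" and gS: "g (- 1 / w) = g w" if "w \<in> UHP" for w
    using T[OF that] S[OF that] by (simp_all add: g_def)
  have g0: "(g \<longlongrightarrow> 0) at_cusp" unfolding g_def using tendsto_diff[OF lim tendsto_const[of c]] by simp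
  have pos: "norm (g z) > 0" using ne by (simp add: g_def)
  have "\<forall>\<^sub>F w in at_cusp. dist (g w) 0 < norm (g z)" by (rule tendstoD[OF g0 pos])
  then obtain Y where Y: "\<And>w. Im w > Y \<Longrightarrow> norm (g w) < norm (g z)"
    unfolding eventually_at_cusp by auto
  define K where "K = cbox (Complex (-1/2) (1/2)) (Complex (1/2) Y)"
  have Kmem: "w \<in> K \<longleftrightarrow> \<bar>Re w\<bar> \<le> 1/2 \<and> 1/2 \<le> Im w \<and> Im w \<le> Y" for w
    unfolding K_def by (auto simp: in_cbox_complex_iff)
  have KU: "K \<subseteq> UHP" by (auto simp: Kmem UHP_def)
  have red: "\<exists>w. (w \<in> K \<or> norm (g w) < norm (g z)) \<and> g w = g v" if v: "v \<in> UHP" for v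
  proof -
    obtain w where "\<bar>Re w\<bar> \<le> 1/2" "Im w \<ge> 1/2" "g w = g v"
      using invariant_reduction[of g, OF gT gS v] by blast
    then show ?thesis using Y[of w] by (cases "Im w > Y") (auto simp: Kmem intro!: exI[of _ w])
  qed
  obtain z' where z': "z' \<in> K" "g z' = g z" using red[OF z] by (metis less_irrefl)
  have "compact K" "K \<noteq> {}" using z' by (auto simp: K_def)
  moreover have "continuous_on K (\<lambda>w. norm (g w))"
    by (intro continuous_on_norm continuous_on_subset[OF holomorphic_on_imp_continuous_on[OF g] KU])
  ultimately obtain m where m: "m \<in> K" "\<And>w. w \<in> K \<Longrightarrow> norm (g w) \<le> norm (g m)"
    using continuous_attains_sup[of K "\<lambda>w. norm (g w)"] by auto
  have mz: "norm (g z) \<le> norm (g m)" using m(2)[OF z'(1)] z' by simp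
  have max: "norm (g w) \<le> norm (g m)" if "w \<in> UHP" for w
    using red[OF that] m(2) mz by (metis less_imp_le order_trans)
  have "g constant_on UHP"
    by (rule maximum_modulus_principle[OF g open_UHP connected_UHP open_UHP subset_refl])
      (use m KU max in auto)
  then have "g w = g z" if "w \<in> UHP" for w using that z by (auto simp: constant_on_def)
  then have "(g \<longlongrightarrow> g z) at_cusp" by (intro tendsto_at_cusp_cong[OF tendsto_const]) simp
  then have "g z = 0" using g0 tendsto_unique[OF at_cusp_neq_bot] by blast
  with pos show False by simp
qed

section \<open>From the generators S and T to the modular group, and q-expansions\<close>

lemma moebius_UHP:
  fixes a b c d :: int
  assumes det: "a * d - b * c = 1" and z: "z \<in> UHP"
  shows "of_int c * z + of_int d \<noteq> 0"
    and "(of_int a * z + of_int b) / (of_int c * z + of_int d) \<in> UHP"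
proof -
  have y: "Im z > 0" using z by (simp add: UHP_def)
  show nz: "of_int c * z + of_int d \<noteq> 0"
  proof
    assume 0: "of_int c * z + of_int d = 0"
    then have "Im (of_int c * z + of_int d) = 0" by simp
    then have "c = 0" using y by simp
    with 0 det show False by simp
  qed
  let ?u = "of_int a * z + of_int b" and ?v = "of_int c * z + of_int d"
  have "Im (?u / ?v) = Im (?u * cnj ?v) / (norm ?v)\<^sup>2"
    unfolding complex_div_cnj[of ?u ?v] by (simp add: Im_divide_of_real[symmetric])
  moreover have "Im (?u * cnj ?v) = of_int (a * d - b * c) * Im z"
    by (simp add: algebra_simps)
  ultimately have "Im (?u / ?v) = Im z / (norm ?v)\<^sup>2" unfolding det by simp
  then show "?u / ?v \<in> UHP" using y nz by (simp add: UHP_def)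
qed

text \<open>The Euclidean algorithm on the first column: a power of T replaces a by a mod c and S
  exchanges the rows, so |c| drops. The even weight absorbs the sign of minus the identity.\<close>

lemma modular_from_generators:
  fixes f :: "complex \<Rightarrow> complex"
  assumes T: "\<And>z. z \<in> UHP \<Longrightarrow> f (z + 1) = f z"
    and S: "\<And>z. z \<in> UHP \<Longrightarrow> f (- 1 / z) = z ^ w * f z"
    and w: "even w"
    and A: "A \<in> SL2Z" and z: "z \<in> UHP"
  shows "f (moeb A z) = jfac A z ^ w * f z"
proof -
  have "f ((of_int a * z + of_int b) / (of_int c * z + of_int d)) = (of_int c * z + of_int d) ^ w * f z"
    if "a * d - b * c = 1" for a b c d :: int
    using that
  proof (induction "nat \<bar>c\<bar>" arbitrary: a b c d rule: less_induct)
    case less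
    show ?case
    proof (cases "c = 0")
      case True
      then have "a * d = 1" using less.prems by simp
      then consider "a = 1" "d = 1" | "a = -1" "d = -1" by (auto simp: zmult_eq_1_iff)
      then show ?thesis
      proof cases
        case 1
        then show ?thesis using True invariant_translate[of f, OF T z, of b] by simp
      next
        case 2
        then show ?thesis using True invariant_translate[of f, OF T z, of "- b"] w by simp
      qed
    next
      case False
      define q where "q = a div c"
      define a' b' where "a' = a - q * c" and "b' = b - q * d"
      have a': "a' = a mod c" unfolding a'_def q_def by (simp add: minus_div_mult_eq_mod)
      have det: "a' * d - b' * c = 1" using less.prems unfolding a'_def b'_def by (simp add: algebra_simps)
      have det': "(- c) * b' - (- d) * a' = 1" using det by (simp add: algebra_simps)
      have lt: "nat \<bar>a'\<bar> < nat \<bar>c\<bar>" unfolding a' using abs_mod_less[OF False, of a] by simp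
      define u where "u = (of_int a' * z + of_int b') / (of_int c * z + of_int d)"
      \<comment> \<open>\<open>v\<close> is -1/u; its matrix has the remainder a' as lower left
        entry, so the induction hypothesis applies to it.\<close>
      define v where "v = (of_int (- c) * z + of_int (- d)) / (of_int a' * z + of_int b')"
      have vnz: "of_int a' * z + of_int b' \<noteq> 0" and vU: "v \<in> UHP"
        using moebius_UHP[OF det' z] unfolding v_def by auto
      have cnz: "of_int c * z + of_int d \<noteq> 0" and uU: "u \<in> UHP"
        using moebius_UHP[OF det z] unfolding u_def by auto
      have "(of_int a * z + of_int b) / (of_int c * z + of_int d) = u + of_int q"
        unfolding u_def a'_def b'_def using cnz by (simp add: field_simps)
      then have "f ((of_int a * z + of_int b) / (of_int c * z + of_int d)) = f u"
        using invariant_translate[of f, OF T uU] by simp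
      also have "u = - 1 / v"
      proof -
        have "v = - ((of_int c * z + of_int d) / (of_int a' * z + of_int b'))"
          unfolding v_def by (simp add: minus_divide_left)
        moreover have "X / Y = - 1 / (- (Y / X))" for X Y :: complex by simp
        ultimately show ?thesis unfolding u_def by metis
      qed
      also have "f (- 1 / v) = v ^ w * f v" by (rule S[OF vU])
      also have "f v = (of_int a' * z + of_int b') ^ w * f z"
        unfolding v_def by (rule less.hyps[OF lt det'])
      also have "v ^ w * ((of_int a' * z + of_int b') ^ w * f z) =
          (v * (of_int a' * z + of_int b')) ^ w * f z" by (simp add: power_mult_distrib)
      also have "v * (of_int a' * z + of_int b') = - (of_int c * z + of_int d)"
        unfolding v_def using vnz by (simp add: field_simps)
      also have "(- (of_int c * z + of_int d)) ^ w = (of_int c * z + of_int d) ^ w"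
        using w by (rule power_minus_even)
      finally show ?thesis .
    qed
  qed
  moreover have "A $ 1 $ 1 * A $ 2 $ 2 - A $ 1 $ 2 * A $ 2 $ 1 = 1"
    using A by (simp add: SL2Z_def det_2)
  ultimately show ?thesis unfolding moeb_def jfac_def by blast
qed

text \<open>Periodicity lets f factor through q as a function on the punctured disc, and the limit
  at the cusp makes 0 a removable singularity.\<close>

lemma q_expansion_exists:
  assumes hol: "f holomorphic_on UHP"
    and T: "\<And>z. z \<in> UHP \<Longrightarrow> f (z + 1) = f z"
    and lim: "(f \<longlongrightarrow> L) at_cusp"
  shows "\<exists>c. \<forall>z\<in>UHP. (\<lambda>t. c t * qpow (real t) z) sums f z"
proof -
  define \<phi> where "\<phi> = (\<lambda>x. Ln x / (2 * of_real pi * \<i>))"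
  define G where "G = (\<lambda>x. f (\<phi> x))"
  have Im\<phi>: "Im (\<phi> x) = - ln (norm x) / (2 * pi)" if "x \<noteq> 0" for x
    using that unfolding \<phi>_def by (simp add: Im_divide_of_real[symmetric] Im_divide power2_eq_square)
  have \<phi>U: "\<phi> x \<in> UHP" if "x \<noteq> 0" "norm x < 1" for x
    using that Im\<phi>[OF that(1)] by (simp add: UHP_def divide_neg_pos)
  have q\<phi>: "q1 (\<phi> x) = x" if "x \<noteq> 0" for x
    using that unfolding q1_def \<phi>_def by simp
  have G: "f z = G (q1 z)" if z: "z \<in> UHP" for z
  proof -
    have nz: "q1 z \<noteq> 0" unfolding q1_def by simp
    have "q1 (\<phi> (q1 z)) = q1 z" by (rule q\<phi>[OF nz])
    then obtain n :: int where "2 * of_real pi * \<i> * \<phi> (q1 z) = 2 * of_real pi * \<i> * z + of_int (2 * n) * (of_real pi * \<i>)"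
      unfolding q1_def exp_eq by (auto simp: mult_ac)
    then have "2 * of_real pi * \<i> * \<phi> (q1 z) = 2 * of_real pi * \<i> * (z + of_int n)"
      by (simp add: algebra_simps)
    then have "\<phi> (q1 z) = z + of_int n" by simp
    then show ?thesis unfolding G_def using invariant_translate[of f, OF T z] by simp
  qed
  have "G holomorphic_on ball 0 1 - {0}"
  proof (rule holomorphic_onI)
    fix x0 :: complex assume x0: "x0 \<in> ball 0 1 - {0}"
    then have nz: "x0 \<noteq> 0" "norm x0 < 1" by auto
    \<comment> \<open>The principal logarithm in \<open>\<phi>\<close> jumps across the negative
      axis. \<open>\<psi>\<close> is a branch recentred at \<open>x0\<close>, with Ln evaluated near
      1; by periodicity f takes the same values on both.\<close>
    define \<psi> where "\<psi> = (\<lambda>x. \<phi> x0 + Ln (x / x0) / (2 * of_real pi * \<i>))"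
    have \<psi>0: "\<psi> x0 = \<phi> x0" using nz by (simp add: \<psi>_def)
    have "(\<lambda>x. f (\<psi> x)) field_differentiable (at x0)"
    proof -
      have "\<psi> field_differentiable (at x0)"
        unfolding \<psi>_def field_differentiable_def using nz
        by (auto intro!: derivative_eq_intros exI)
      moreover have "f field_differentiable (at (\<psi> x0))"
        using DERIV_in_UHP[OF hol \<phi>U[OF nz]] unfolding \<psi>0 field_differentiable_def by blast
      ultimately show ?thesis using field_differentiable_compose[of \<psi> x0 f] by (simp add: o_def)
    qed
    then obtain D where D: "((\<lambda>x. f (\<psi> x)) has_field_derivative D) (at x0)"
      unfolding field_differentiable_def by blast
    have "(G has_field_derivative D) (at x0)"
    proof (rule has_field_derivative_transform_within_open[OF D])
      show "open (ball (0::complex) 1 - {0})" by (intro open_Diff) auto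
      show "x0 \<in> ball 0 1 - {0}" by (rule x0)
      fix x :: complex assume "x \<in> ball 0 1 - {0}"
      then have x: "x \<noteq> 0" "norm x < 1" by auto
      have qx: "q1 (\<psi> x) = x"
      proof -
        have "q1 (\<psi> x) = q1 (\<phi> x0) * exp (Ln (x / x0))"
          unfolding q1_def \<psi>_def exp_add[symmetric] by (simp add: algebra_simps)
        then show ?thesis using x nz q\<phi>[OF nz(1)] by simp
      qed
      have "\<psi> x \<in> UHP"
      proof -
        have "norm (q1 (\<psi> x)) < 1" using x(2) qx by simp
        then have "exp (- (2 * pi * Im (\<psi> x))) < 1" by (simp add: q1_def)
        then show ?thesis by (simp add: UHP_def zero_less_mult_iff)
      qed
      from G[OF this] show "f (\<psi> x) = G x" unfolding qx .
    qed
    then show "G field_differentiable at x0 within ball 0 1 - {0}"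
      unfolding field_differentiable_def using has_field_derivative_at_within by blast
  qed
  moreover have "G \<midarrow>0\<rightarrow> L"
  proof -
    have "filterlim (\<lambda>x::complex. norm x) (at_right 0) (at 0)"
      unfolding filterlim_at by (auto simp: eventually_at_filter intro!: tendsto_eq_intros)
    then have "filterlim (\<lambda>x::complex. ln (norm x)) at_bot (at 0)"
      by (rule filterlim_compose[OF ln_at_0])
    then have "filterlim (\<lambda>x::complex. - ln (norm x)) at_top (at 0)"
      by (simp add: filterlim_uminus_at_top)
    then have "filterlim (\<lambda>x::complex. 1 / (2 * pi) * (- ln (norm x))) at_top (at 0)"
      by (intro filterlim_tendsto_pos_mult_at_top[OF tendsto_const]) auto
    moreover have "\<forall>\<^sub>F x in at 0. Im (\<phi> x) = 1 / (2 * pi) * (- ln (norm x))"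
      by (auto simp: eventually_at_filter Im\<phi>)
    ultimately have "filterlim (\<lambda>x. Im (\<phi> x)) at_top (at 0)"
      by (subst filterlim_cong[OF refl refl])
    then have "filterlim \<phi> at_cusp (at 0)" by (simp add: filterlim_filtercomap_iff o_def)
    then show ?thesis unfolding G_def by (rule filterlim_compose[OF lim])
  qed
  ultimately have g: "(\<lambda>y. if y = 0 then L else G y) holomorphic_on ball 0 1"
    by (intro removable_singularity) auto
  define c where "c = (\<lambda>n. (deriv ^^ n) (\<lambda>y. if y = 0 then L else G y) 0 / fact n)"
  have "(\<lambda>t. c t * qpow (real t) z) sums f z" if z: "z \<in> UHP" for z
  proof -
    have nz: "q1 z \<noteq> 0" unfolding q1_def by simp
    have "q1 z \<in> ball 0 1" using norm_q1_less_1[OF z] by simp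
    from holomorphic_power_series[OF g this] show ?thesis
      unfolding c_def qpow_of_nat q1_def[symmetric] using nz G[OF z] by simp
  qed
  then show ?thesis by blast
qed

text \<open>A power series in q^m: convergence at z = i already gives a positive radius of
  convergence, hence continuity at 0.\<close>

lemma tendsto_q_series_at_cusp:
  assumes m: "m > 0" and sums: "\<And>z. z \<in> UHP \<Longrightarrow> (\<lambda>t. c t * qpow (m * real t) z) sums f z"
  shows "(f \<longlongrightarrow> c 0) at_cusp"
proof -
  have pow: "qpow (m * real t) z = qpow m z ^ t" for t z
    unfolding qpow_def exp_of_nat_mult[symmetric] by (simp add: algebra_simps)
  have "summable (\<lambda>t. c t * qpow m \<i> ^ t)"
    using sums[OF i_in_UHP] unfolding pow by (rule sums_summable)
  then have "isCont (\<lambda>x. \<Sum>t. c t * x ^ t) 0" by (rule isCont_powser) simp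
  then have "((\<lambda>z. \<Sum>t. c t * qpow m z ^ t) \<longlongrightarrow> (\<Sum>t. c t * 0 ^ t)) at_cusp"
    by (rule isCont_tendsto_compose[OF _ tendsto_qpow_at_cusp[OF m]])
  then have "((\<lambda>z. \<Sum>t. c t * qpow m z ^ t) \<longlongrightarrow> c 0) at_cusp" unfolding powser_zero .
  then show ?thesis
    by (rule tendsto_at_cusp_cong) (use sums pow in \<open>simp add: sums_iff\<close>)
qed

definition matS :: "int^2^2" where
  "matS = (\<chi> i j. if i = j then 0 else if i = 1 then -1 else 1)"

definition matT :: "int^2^2" where
  "matT = (\<chi> i j. if i = 2 \<and> j = 1 then 0 else 1)"

lemma matS: "matS \<in> SL2Z" "moeb matS z = - 1 / z" "jfac matS z = z"
  by (simp_all add: SL2Z_def det_2 matS_def moeb_def jfac_def)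

lemma matT: "matT \<in> SL2Z" "moeb matT z = z + 1" "jfac matT z = 1"
  by (simp_all add: SL2Z_def det_2 matT_def moeb_def jfac_def)

text \<open>A primitive of \<open>f\<close> is invariant up to additive constants; these vanish because \<open>S\<close> and
  \<open>ST\<close> have the fixed points \<open>\<i>\<close> and \<open>(-1 + \<i>\<surd>3) / 2\<close>.\<close>
lemma weight_2_constant_term:
  assumes f: "modular_form 2 f" and lim: "(f \<longlongrightarrow> c) at_cusp"
  shows "c = 0"
proof -
  have hol: "f holomorphic_on UHP" using f by (simp add: modular_form_def)
  have inv: "f (moeb A z) = jfac A z ^ 2 * f z" if "A \<in> SL2Z" "z \<in> UHP" for A z
    using f that by (simp add: modular_form_def)
  have fS: "f (- 1 / z) = z\<^sup>2 * f z" if "z \<in> UHP" for z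
    using inv[OF matS(1) that] unfolding matS .
  have fT: "f (z + 1) = f z" if "z \<in> UHP" for z
    using inv[OF matT(1) that] unfolding matT by simp
  obtain P where P': "\<And>z. z \<in> UHP \<Longrightarrow> (P has_field_derivative f z) (at z within UHP)"
    using holomorphic_convex_primitive'[OF convex_UHP open_UHP hol] by blast
  then have P: "(P has_field_derivative f z) (at z)" if "z \<in> UHP" for z
    using that at_within_open[OF that open_UHP] by metis
  have Phol: "P holomorphic_on UHP" using P by (subst holomorphic_on_open[OF open_UHP]) blast
  have "\<exists>s. \<forall>z\<in>UHP. P (- 1 / z) - P z = s"
  proof (rule has_field_derivative_zero_constant[OF convex_UHP])
    fix z assume z: "z \<in> UHP"
    have "deriv P (- 1 / z) / z\<^sup>2 - f z = 0"
      using DERIV_imp_deriv[OF P[OF UHP_S[OF z]]] fS[OF z] UHP_nonzero[OF z] by simp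
    then show "((\<lambda>z. P (- 1 / z) - P z) has_field_derivative 0) (at z within UHP)"
      using has_field_derivative_at_within[OF DERIV_diff[OF DERIV_S[OF Phol z] P[OF z]]] by metis
  qed
  then obtain s where s: "\<And>z. z \<in> UHP \<Longrightarrow> P (- 1 / z) - P z = s" by blast
  have "s = 0" using s[OF i_in_UHP] by simp
  then have PS: "P (- 1 / z) = P z" if "z \<in> UHP" for z using s[OF that] by simp
  have "\<exists>t. \<forall>z\<in>UHP. P (z + 1) - P z = t"
  proof (rule has_field_derivative_zero_constant[OF convex_UHP])
    fix z assume z: "z \<in> UHP"
    have "((\<lambda>z. P (z + 1) - P z) has_field_derivative f (z + 1) * 1 - f z) (at z)"
      using z by (intro DERIV_diff P DERIV_chain2[OF P]) (auto simp: UHP_T intro!: derivative_eq_intros)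
    then show "((\<lambda>z. P (z + 1) - P z) has_field_derivative 0) (at z within UHP)"
      using has_field_derivative_at_within fT[OF z] by simp
  qed
  then obtain t where t: "\<And>z. z \<in> UHP \<Longrightarrow> P (z + 1) - P z = t" by blast
  define \<omega> where "\<omega> = Complex (- 1/2) (sqrt 3 / 2)"
  have \<omega>: "\<omega> \<in> UHP" by (simp add: \<omega>_def UHP_def)
  \<comment> \<open>Equivalent to -1/(\<omega> + 1) = \<omega>, the fixed point equation of
    ST.\<close>
  have "\<omega> * (\<omega> + 1) = - 1" unfolding \<omega>_def by (simp add: complex_eq_iff)
  moreover have "\<omega> + 1 \<in> UHP" using \<omega> by (simp add: UHP_T)
  moreover from this have "\<omega> + 1 \<noteq> 0" by (rule UHP_nonzero)
  ultimately have "\<omega> = - 1 / (\<omega> + 1)" using nonzero_eq_divide_eq by blast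
  then have "P \<omega> = P (\<omega> + 1)" using PS[OF \<open>\<omega> + 1 \<in> UHP\<close>] by simp
  then have "t = 0" using t[OF \<omega>] by simp
  then have PT: "P (z + 1) = P z" if "z \<in> UHP" for z using t[OF that] by simp
  \<comment> \<open>P(z + 1) - P(z) is the mean of f over a horizontal period. It is close to c when
    z is high, and it has just been shown to vanish.\<close>
  have "norm c \<le> 0 + e" if e: "e > 0" for e
  proof -
    have "\<forall>\<^sub>F z in at_cusp. dist (f z) c < e" using lim e by (rule tendstoD)
    then obtain Y where Y: "Y > 0" "\<And>z. Im z > Y \<Longrightarrow> dist (f z) c < e"
      unfolding eventually_at_cusp by blast
    define z where "z = Complex 0 (Y + 1)"
    have z: "z \<in> UHP" using Y by (simp add: z_def UHP_def)
    have "norm ((P (z + 1) - c * (z + 1)) - (P z - c * z)) \<le> e * norm (z + 1 - z)"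
    proof (rule field_differentiable_bound[where S = "{w. Im w > Y}" and f' = "\<lambda>w. f w - c"])
      show "convex {w. Im w > Y}" by (rule convex_halfspace_Im_gt)
      show "((\<lambda>w. P w - c * w) has_field_derivative f w - c) (at w within {w. Im w > Y})"
        if "w \<in> {w. Im w > Y}" for w
        using that Y(1) by (intro has_field_derivative_at_within[OF DERIV_diff[OF P]])
          (auto simp: UHP_def intro!: derivative_eq_intros)
      show "norm (f w - c) \<le> e" if "w \<in> {w. Im w > Y}" for w
        using Y(2)[of w] that by (simp add: dist_norm)
    qed (use Y in \<open>auto simp: z_def\<close>)
    then show ?thesis using PT[OF z] by (simp add: algebra_simps)
  qed
  then have "norm c \<le> 0" by (rule field_le_epsilon)
  then show ?thesis by simp
qed

section \<open>Wronskians\<close>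

lemma degree_coeff_prod_linear:
  fixes x :: "'a \<Rightarrow> 'b::comm_ring_1"
  assumes "finite A"
  shows "degree (\<Prod>i\<in>A. [:- x i, 1:]) \<le> card A \<and> coeff (\<Prod>i\<in>A. [:- x i, 1:]) (card A) = 1 \<and>
    (card A = Suc m \<longrightarrow> coeff (\<Prod>i\<in>A. [:- x i, 1:]) m = - sum x A)"
  using assms
proof (induction A arbitrary: m)
  case (insert y A)
  let ?p = "\<Prod>i\<in>A. [:- x i, 1:]"
  have IH: "degree ?p \<le> card A" "coeff ?p (card A) = 1" using insert.IH by auto
  have prod: "(\<Prod>i\<in>insert y A. [:- x i, 1:]) = [:- x y, 1:] * ?p" using insert by simp
  have c: "coeff ([:- x y, 1:] * ?p) (Suc j) = coeff ?p j - x y * coeff ?p (Suc j)" for j by simp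
  have "degree ([:- x y, 1:] * ?p) \<le> Suc (card A)"
  proof (rule degree_le, intro allI impI)
    fix i assume i: "Suc (card A) < i"
    then obtain j where j: "i = Suc j" by (cases i) auto
    then have "coeff ?p j = 0" "coeff ?p (Suc j) = 0" using i IH(1) by (auto intro!: coeff_eq_0)
    then show "coeff ([:- x y, 1:] * ?p) i = 0" unfolding j c by simp
  qed
  moreover have "coeff ([:- x y, 1:] * ?p) (Suc (card A)) = 1"
    unfolding c using IH(2) coeff_eq_0[OF le_less_trans[OF IH(1)], of "Suc (card A)"] by simp
  moreover have "coeff ([:- x y, 1:] * ?p) m = - (x y + sum x A)" if "card A = m"
  proof (cases m)
    case 0
    then have "A = {}" using that insert by simp
    then show ?thesis using 0 by simp
  next
    case (Suc j)
    have "coeff ?p j = - sum x A" using insert.IH[of j] that Suc by simp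
    then show ?thesis unfolding Suc c using IH(2) that Suc by simp
  qed
  ultimately show ?case unfolding prod using insert by simp
qed simp

lemma degree_prod_linear: "finite A \<Longrightarrow> degree (\<Prod>i\<in>A. [:- x i, 1:]) \<le> card A"
  and coeff_card_prod_linear: "finite A \<Longrightarrow> coeff (\<Prod>i\<in>A. [:- x i, 1:]) (card A) = 1"
  and coeff_prod_linear: "finite A \<Longrightarrow> card A = Suc m \<Longrightarrow> coeff (\<Prod>i\<in>A. [:- x i, 1:]) m = - sum x A"
  for x :: "'a \<Rightarrow> 'b::comm_ring_1"
  using degree_coeff_prod_linear by blast+

lemma degree_indicial: "degree (indicial k j) \<le> j"
  unfolding indicial_def using degree_prod_linear[of "{..<j}"] by simp

lemma coeff_indicial: "coeff (indicial k j) j = 1"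
  unfolding indicial_def using coeff_card_prod_linear[of "{..<j}"] by simp

lemma coeff_indicial_gt: "i > j \<Longrightarrow> coeff (indicial k j) i = 0"
  using degree_indicial[of k j] by (intro coeff_eq_0) simp

lemma coeff_indicial_pred:
  "coeff (indicial k (Suc j)) j = - of_real (\<Sum>s<Suc j. (k + 2 * real s) / 12)"
  unfolding indicial_def by (subst coeff_prod_linear) simp_all

lemma sum_indicial_exponents:
  "12 * (\<Sum>s<n. (k + 2 * real s) / 12) = real n * (k + real n - 1)"
  by (induction n) (simp_all add: algebra_simps add_divide_distrib)

section \<open>Determinants and the Wronskian of a vector-valued form\<close>

lemma det_scale_rows:
  fixes A :: "'a::comm_ring_1^'n^'n"
  shows "det (\<chi> i j. c i * A $ i $ j) = (\<Prod>i\<in>UNIV. c i) * det A"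
proof -
  have "(\<chi> i j. c i * A $ i $ j) = (\<chi> i. c i *s A $ i)"
    by (simp add: vec_eq_iff)
  then show ?thesis by (simp add: det_rows_mul)
qed

lemma det_scale_columns:
  fixes A :: "'a::comm_ring_1^'n^'n"
  shows "det (\<chi> i j. c j * A $ i $ j) = (\<Prod>j\<in>UNIV. c j) * det A"
proof -
  have "det (\<chi> i j. c j * A $ i $ j) = det (transpose (\<chi> i j. c j * A $ i $ j))"
    by (simp add: det_transpose)
  also have "transpose (\<chi> i j. c j * A $ i $ j) = (\<chi> i j. c i * transpose A $ i $ j)"
    by (simp add: transpose_def vec_eq_iff)
  also have "det \<dots> = (\<Prod>j\<in>UNIV. c j) * det A" unfolding det_scale_rows det_transpose ..
  finally show ?thesis .
qed

lemma det_holomorphic: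
  fixes A :: "complex \<Rightarrow> complex^'n^'n"
  assumes "\<And>i j. (\<lambda>z. A z $ i $ j) holomorphic_on S"
  shows "(\<lambda>z. det (A z)) holomorphic_on S"
  unfolding det_def by (intro holomorphic_intros assms)

lemma tendsto_det:
  fixes A :: "'a \<Rightarrow> 'b::{real_normed_field}^'n^'n"
  assumes "\<And>i j. ((\<lambda>z. A z $ i $ j) \<longlongrightarrow> B $ i $ j) net"
  shows "((\<lambda>z. det (A z)) \<longlongrightarrow> det B) net"
  unfolding det_def by (intro tendsto_intros assms)

lemma qpow_sum: "qpow (\<Sum>i\<in>A. r i) z = (\<Prod>i\<in>A. qpow (r i) z)"
  by (induction A rule: infinite_finite_induct) (simp_all add: qpow_add)

text \<open>\<open>MS\<close> and \<open>MT\<close> stand for v R at the two generators.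
  \<open>\<nu>\<close> numbers the index type, because the columns of a determinant are indexed by
  \<open>'n\<close> while orders of derivatives are natural numbers below n.\<close>

locale vector_valued_form =
  fixes k :: real
    and f :: "'n::finite \<Rightarrow> complex \<Rightarrow> complex"
    and MS MT :: "complex^'n^'n"
    and lam :: "'n \<Rightarrow> real"
    and a0 :: "'n \<Rightarrow> complex"
    and n :: nat
    and \<nu> :: "'n \<Rightarrow> nat"
  assumes hol: "f i holomorphic_on UHP"
    and form_T: "z \<in> UHP \<Longrightarrow> f i (z + 1) = (\<Sum>j\<in>UNIV. MT $ i $ j * f j z)"
    and form_S: "z \<in> UHP \<Longrightarrow> f i (- 1 / z) = z powr of_real k * (\<Sum>j\<in>UNIV. MS $ i $ j * f j z)"
    and leading: "((\<lambda>z. qpow (- lam i) z * f i z) \<longlongrightarrow> a0 i) at_cusp"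
    and a0_nonzero: "a0 i \<noteq> 0"
    and inj_lam: "inj lam"
    and card_eq: "CARD('n) = n"
    and bij: "bij_betw \<nu> UNIV {..<n}"
begin

definition wt :: real where "wt = real n * (k + real n - 1)"

text \<open>The exponent of \<open>q\<close> at the cusp of the Wronskian divided by \<open>\<eta>\<close> to the power \<open>2 wt\<close>.\<close>
definition defect :: real where "defect = (\<Sum>i\<in>UNIV. lam i) - wt / 12"

text \<open>The column of index \<open>j\<close> holds the derivatives of order \<open>e j\<close>: \<open>wr \<nu>\<close> is the Wronskian, and
  \<open>wr (\<nu>(l := n))\<close> are the minors of Cramer's rule.\<close>
definition wr :: "('n \<Rightarrow> nat) \<Rightarrow> complex \<Rightarrow> complex" where
  "wr e z = det (\<chi> i j. Diter k (e j) (f i) z)"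

text \<open>The limit at the cusp of \<open>wr e\<close> divided by q to the sum of the exponents;
  row i contributes the common factor \<open>a0 i\<close>.\<close>

definition lead :: "('n \<Rightarrow> nat) \<Rightarrow> complex" where
  "lead e = (\<Prod>i\<in>UNIV. a0 i) * det (\<chi> i j. poly (indicial k (e j)) (of_real (lam i)) :: complex^'n^'n)"

lemma n_pos: "n > 0"
  unfolding card_eq[symmetric] by simp

lemma \<nu>_less: "\<nu> j < n"
  using bij unfolding bij_betw_def by auto

lemma inj_\<nu>: "inj \<nu>"
  using bij by (rule bij_betw_imp_inj_on)

lemma sum_\<nu>: "(\<Sum>j\<in>UNIV. g (\<nu> j)) = (\<Sum>s<n. g s)"
  by (rule sum.reindex_bij_betw[OF bij])

lemma wr_holomorphic: "wr e holomorphic_on UHP"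
  unfolding wr_def[abs_def] by (rule det_holomorphic) (simp add: Diter_holomorphic[OF hol])

lemma wr_T:
  assumes z: "z \<in> UHP"
  shows "wr e (z + 1) = det MT * wr e z"
proof -
  have "Diter k (e j) (f i) (z + 1) = (\<Sum>l\<in>UNIV. MT $ i $ l * Diter k (e j) (f l) z)" for i j
  proof -
    have "Diter k (e j) (f i) (z + 1) = Diter k (e j) (\<lambda>z. \<Sum>l\<in>UNIV. MT $ i $ l * f l z) z"
      by (rule Diter_T[OF form_T hol z])
    then show ?thesis using Diter_sum[of UNIV f, OF hol z] by simp
  qed
  then have "(\<chi> i j. Diter k (e j) (f i) (z + 1)) = MT ** (\<chi> i j. Diter k (e j) (f i) z)"
    by (simp add: vec_eq_iff matrix_matrix_mult_def)
  then show ?thesis unfolding wr_def by (simp add: det_mul)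
qed

text \<open>\<open>MS\<close> mixes the rows, while the column of order e j acquires z^(k + 2 e j).
  The power of z therefore depends on the orders through their sum.\<close>

lemma wr_S:
  assumes z: "z \<in> UHP"
  shows "wr e (- 1 / z) = det MS * (z powr of_real k) ^ n * z ^ (2 * (\<Sum>j\<in>UNIV. e j)) * wr e z"
proof -
  let ?g = "\<lambda>i z. \<Sum>l\<in>UNIV. MS $ i $ l * f l z"
  have "Diter k (e j) (f i) (- 1 / z) =
      z powr of_real k * z ^ (2 * e j) * (\<Sum>l\<in>UNIV. MS $ i $ l * Diter k (e j) (f l) z)" for i j
  proof -
    have "?g i holomorphic_on UHP" by (intro holomorphic_intros hol)
    then have "Diter k (e j) (f i) (- 1 / z) = z powr of_real k * z ^ (2 * e j) * Diter k (e j) (?g i) z"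
      by (intro Diter_S form_S hol z)
    then show ?thesis using Diter_sum[of UNIV f, OF hol z] by simp
  qed
  then have "(\<chi> i j. Diter k (e j) (f i) (- 1 / z)) =
      (\<chi> i j. (z powr of_real k * z ^ (2 * e j)) * (MS ** (\<chi> i j. Diter k (e j) (f i) z)) $ i $ j)"
    by (simp add: vec_eq_iff matrix_matrix_mult_def)
  then have "wr e (- 1 / z) = (\<Prod>j\<in>UNIV. z powr of_real k * z ^ (2 * e j)) * (det MS * wr e z)"
    unfolding wr_def by (simp only: det_scale_columns det_mul)
  also have "(\<Prod>j\<in>UNIV. z powr of_real k * z ^ (2 * e j)) = (z powr of_real k) ^ n * z ^ (2 * (\<Sum>j\<in>UNIV. e j))"
    by (simp add: prod.distrib power_sum sum_distrib_left card_eq)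
  finally show ?thesis by (simp add: mult_ac)
qed

lemma tendsto_wr: "((\<lambda>z. qpow (- (\<Sum>i\<in>UNIV. lam i)) z * wr e z) \<longlongrightarrow> lead e) at_cusp"
proof -
  have "((\<lambda>z. det (\<chi> i j. qpow (- lam i) z * Diter k (e j) (f i) z)) \<longlongrightarrow>
      det (\<chi> i j. poly (indicial k (e j)) (of_real (lam i)) * a0 i)) at_cusp"
    by (rule tendsto_det) (simp add: tendsto_Diter_at_cusp[OF hol leading])
  moreover have "det (\<chi> i j. qpow (- lam i) z * Diter k (e j) (f i) z) = qpow (- (\<Sum>i\<in>UNIV. lam i)) z * wr e z" for z
    using det_scale_rows[of "\<lambda>i. qpow (- lam i) z" "\<chi> i j. Diter k (e j) (f i) z"]
    by (simp add: wr_def sum_negf[symmetric] qpow_sum)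
  moreover have "det (\<chi> i j. poly (indicial k (e j)) (of_real (lam i)) * a0 i) = lead e"
    using det_scale_rows[of a0 "\<chi> i j. poly (indicial k (e j)) (of_real (lam i))"]
    by (simp add: lead_def mult.commute)
  ultimately show ?thesis by simp
qed

lemma card_lam: "card (range (\<lambda>i. complex_of_real (lam i))) = n"
  using inj_lam unfolding card_eq[symmetric] by (intro card_image) (auto simp: inj_def)

text \<open>A Vandermonde argument: a vanishing combination of the columns is a polynomial of degree
  below \<open>n\<close> with the \<open>n\<close> roots \<open>\<lambda>\<^sub>i\<close>, and the indicial polynomials have pairwise distinct degrees.\<close>
lemma lead_\<nu>_nonzero: "lead \<nu> \<noteq> 0"
proof -
  define A :: "complex^'n^'n" where "A = (\<chi> i j. poly (indicial k (\<nu> j)) (of_real (lam i)))"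
  have "x = 0" if x: "A *v x = 0" for x
  proof (rule ccontr)
    assume nz: "x \<noteq> 0"
    define p where "p = (\<Sum>j\<in>UNIV. smult (x $ j) (indicial k (\<nu> j)))"
    have "degree p \<le> n - 1"
      unfolding p_def
    proof (intro degree_sum_le)
      fix j :: 'n
      show "degree (smult (x $ j) (indicial k (\<nu> j))) \<le> n - 1"
        using degree_smult_le[of "x $ j" "indicial k (\<nu> j)"] degree_indicial[of k "\<nu> j"] \<nu>_less[of j] by linarith
    qed simp
    then have deg: "degree p < n" using n_pos by linarith
    have "poly p (of_real (lam i)) = (A *v x) $ i" for i
      unfolding p_def A_def matrix_vector_mult_def by (simp add: poly_sum mult.commute)
    then have "poly p y = poly 0 y" if "y \<in> range (\<lambda>i. complex_of_real (lam i))" for y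
      using that x by auto
    then have p0: "p = 0"
      by (rule poly_eqI_degree) (use deg card_lam in auto)
    \<comment> \<open>In the vanishing combination take the column of highest order: it alone
      reaches degree \<open>\<nu> j\<close>, with leading coefficient 1, so its coefficient would
      have to vanish.\<close>
    define J where "J = {j. x $ j \<noteq> 0}"
    have J: "finite (\<nu> ` J)" "\<nu> ` J \<noteq> {}" using nz by (auto simp: J_def vec_eq_iff)
    obtain j where j: "j \<in> J" "\<nu> j = Max (\<nu> ` J)" using Max_in[OF J] by auto
    have "coeff p (\<nu> j) = (\<Sum>l\<in>UNIV. x $ l * coeff (indicial k (\<nu> l)) (\<nu> j))"
      by (simp add: p_def coeff_sum)
    also have "\<dots> = (\<Sum>l\<in>UNIV. if l = j then x $ j else 0)"
    proof (rule sum.cong)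
      fix l :: 'n
      show "x $ l * coeff (indicial k (\<nu> l)) (\<nu> j) = (if l = j then x $ j else 0)"
      proof (cases "l = j \<or> x $ l = 0")
        case True
        then show ?thesis using coeff_indicial by auto
      next
        case False
        then have "\<nu> l \<le> \<nu> j" unfolding j(2) using J(1) by (auto simp: J_def)
        moreover have "\<nu> l \<noteq> \<nu> j" using False inj_\<nu> by (auto dest: injD)
        ultimately show ?thesis using False coeff_indicial_gt by simp
      qed
    qed simp
    also have "\<dots> = x $ j" by simp
    finally show False using p0 j(1) by (simp add: J_def)
  qed
  then have "invertible A" unfolding invertible_left_inverse matrix_left_invertible_ker by blast
  then have "det A \<noteq> 0" by (simp add: invertible_det_nz)
  then show ?thesis unfolding lead_def A_def using a0_nonzero by simp
qed

text \<open>exp(wt * \<open>ln_eta2\<close>) is eta to the power 2 wt and has the weight of the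
  Wronskian, so \<open>u \<nu>\<close> has weight 0. For other column orders the weight is twice the
  surplus in their sum.\<close>

definition u :: "('n \<Rightarrow> nat) \<Rightarrow> complex \<Rightarrow> complex" where
  "u e z = wr e z * exp (- of_real wt * ln_eta2 z)"

text \<open>The multiplier of \<open>u\<close> under T, as \<open>cS\<close> is under S: a
  determinant times the constant from the law of \<open>ln_eta2\<close>. These numbers are never
  evaluated; the proof works with their sixth powers.\<close>

definition cT :: complex where "cT = det MT * exp (- of_real wt * (2 * of_real pi * \<i> / 12))"

definition cS :: complex where "cS = det MS * exp (of_real wt * (\<i> * of_real pi / 2))"

lemma u_holomorphic: "u e holomorphic_on UHP"
  unfolding u_def[abs_def] by (intro holomorphic_intros wr_holomorphic ln_eta2_holomorphic)

lemma u_T: "z \<in> UHP \<Longrightarrow> u e (z + 1) = cT * u e z"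
  unfolding u_def cT_def wr_T ln_eta2_T distrib_left exp_add by (simp add: mult_ac)

text \<open>The orders in e exceed those in \<open>\<nu>\<close> by i in total. Writing every power
  of z through Ln z makes the real weight \<open>wt\<close> cancel exactly, with no branch left to
  compare.\<close>

lemma u_S:
  assumes z: "z \<in> UHP" and e: "2 * (\<Sum>j\<in>UNIV. e j) = n * (n - 1) + 2 * i"
  shows "u e (- 1 / z) = cS * z ^ (2 * i) * u e z"
proof -
  have nz: "z \<noteq> 0" by (rule UHP_nonzero[OF z])
  have pk: "(z powr of_real k) ^ n = exp (of_nat n * (of_real k * Ln z))"
    using nz by (simp add: powr_def exp_of_nat_mult)
  have pn: "z ^ (n * (n - 1)) = exp (of_nat (n * (n - 1)) * Ln z)"
    unfolding exp_of_nat_mult using nz by simp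
  have wt: "complex_of_real wt = of_nat n * of_real k + of_nat (n * (n - 1))"
    unfolding wt_def using n_pos by (simp add: algebra_simps of_nat_diff)
  have "exp (- of_real wt * (ln_eta2 z + Ln z - \<i> * of_real pi / 2)) * ((z powr of_real k) ^ n * z ^ (n * (n - 1))) =
      exp (- of_real wt * ln_eta2 z) * exp (of_real wt * (\<i> * of_real pi / 2))"
    unfolding pk pn exp_add[symmetric] unfolding wt
    by (rule arg_cong[where f = exp]) (simp add: algebra_simps)
  then show ?thesis
    unfolding u_def wr_S[OF z] e ln_eta2_S[OF z] power_add cS_def
    by (simp add: mult_ac)
qed

text \<open>The summand 2 * 0 gives this the shape of the hypothesis of \<open>u_S\<close> and
  \<open>G_S\<close> with i = 0.\<close>

lemma sum_\<nu>_eq: "2 * (\<Sum>j\<in>UNIV. \<nu> j) = n * (n - 1) + 2 * 0"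
proof -
  have "2 * (\<Sum>s<m. s) = m * (m - 1)" for m :: nat
    by (induction m) (auto simp: algebra_simps diff_mult_distrib2 split: nat_diff_split)
  then show ?thesis using sum_\<nu>[of "\<lambda>s. s"] by simp
qed

text \<open>The order in column l rises from \<open>\<nu> l\<close> to n, so the minor has surplus
  weight 2 i for i = n - \<open>\<nu> l\<close>, as required of the i-th coefficient of an
  MLDE.\<close>

lemma sum_\<nu>_upd_eq: "2 * (\<Sum>j\<in>UNIV. (\<nu>(l := n)) j) = n * (n - 1) + 2 * (n - \<nu> l)"
proof -
  have "(\<Sum>j\<in>UNIV. (\<nu>(l := n)) j) = n + (\<Sum>j\<in>UNIV - {l}. \<nu> j)"
    by (subst sum.remove[of _ l]) auto
  moreover have "(\<Sum>j\<in>UNIV. \<nu> j) = \<nu> l + (\<Sum>j\<in>UNIV - {l}. \<nu> j)"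
    by (subst sum.remove[of _ l]) auto
  ultimately show ?thesis using sum_\<nu>_eq \<nu>_less[of l] by linarith
qed

lemma tendsto_u: "((\<lambda>z. qpow (- defect) z * u e z) \<longlongrightarrow> lead e) at_cusp"
proof -
  have "((\<lambda>z. (qpow (- (\<Sum>i\<in>UNIV. lam i)) z * wr e z) *
      (exp (of_real (- wt) * ln_eta2 z) * qpow (- (- wt) / 12) z)) \<longlongrightarrow> lead e * 1) at_cusp"
    by (intro tendsto_mult tendsto_wr tendsto_exp_ln_eta2_at_cusp)
  moreover have "(qpow (- (\<Sum>i\<in>UNIV. lam i)) z * wr e z) *
      (exp (of_real (- wt) * ln_eta2 z) * qpow (- (- wt) / 12) z) = qpow (- defect) z * u e z" for z
  proof -
    have "qpow (- defect) z = qpow (- (\<Sum>i\<in>UNIV. lam i)) z * qpow (- (- wt) / 12) z"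
      unfolding qpow_add[symmetric] defect_def by (simp add: algebra_simps)
    then show ?thesis unfolding u_def by (simp add: mult_ac)
  qed
  ultimately show ?thesis by simp
qed

lemma u_\<nu>_nonzero: "\<exists>z\<in>UHP. u \<nu> z \<noteq> 0"
proof -
  have "\<forall>\<^sub>F z in at_cusp. qpow (- defect) z * u \<nu> z \<noteq> 0"
    by (rule tendsto_imp_eventually_ne[OF tendsto_u lead_\<nu>_nonzero])
  then have "\<forall>\<^sub>F z in at_cusp. z \<in> UHP \<and> u \<nu> z \<noteq> 0"
    using eventually_at_cusp_UHP by eventually_elim auto
  then show ?thesis using eventually_happens'[OF at_cusp_neq_bot] by blast
qed

text \<open>Holds because \<open>S\<^sup>2\<close> and \<open>(ST)\<^sup>3\<close> act trivially on the upper half plane and \<open>u \<nu>\<close> is not identically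
  zero.\<close>
lemma cS_cT_pow_6: "cS ^ 6 = 1" "cT ^ 6 = 1"
proof -
  obtain z where z: "z \<in> UHP" "u \<nu> z \<noteq> 0" using u_\<nu>_nonzero by blast
  have S: "u \<nu> (- 1 / w) = cS * u \<nu> w" if "w \<in> UHP" for w
    using u_S[OF that sum_\<nu>_eq] by simp
  have "u \<nu> (- 1 / (- 1 / z)) = cS * (cS * u \<nu> z)"
    unfolding S[OF UHP_S[OF z(1)]] S[OF z(1)] ..
  moreover have "- 1 / (- 1 / z) = z" using UHP_nonzero[OF z(1)] by simp
  ultimately have c2: "cS ^ 2 = 1" using z(2) by (simp add: power2_eq_square)
  have "cS ^ 6 = (cS ^ 2) ^ 3" by (simp flip: power_mult)
  then show c6: "cS ^ 6 = 1" using c2 by simp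
  \<comment> \<open>With ST z = -1/(z + 1), \<open>z1\<close> and \<open>z2\<close> are the first
    two iterates, and the third is z again.\<close>
  define z1 where "z1 = - 1 / (z + 1)"
  define z2 where "z2 = - 1 / (z1 + 1)"
  have zU: "z + 1 \<in> UHP" using z by (simp add: UHP_T)
  have z1: "z1 \<in> UHP" "z1 + 1 \<in> UHP" unfolding z1_def UHP_T using UHP_S[OF zU] by auto
  have z2: "z2 \<in> UHP" "z2 + 1 \<in> UHP" unfolding z2_def UHP_T using UHP_S[OF z1(2)] by auto
  have nz: "z \<noteq> 0" "z + 1 \<noteq> 0" using z zU UHP_nonzero by auto
  have z1_eq: "z1 + 1 = z / (z + 1)" unfolding z1_def using nz by (simp add: field_simps)
  have "z2 + 1 = - 1 / z" unfolding z2_def z1_eq using nz by (simp add: field_simps)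
  then have "u \<nu> z = u \<nu> (- 1 / (z2 + 1))" using nz by simp
  also have "\<dots> = (cS * cT) * u \<nu> z2" using S[OF z2(2)] u_T[OF z2(1)] by simp
  also have "u \<nu> z2 = (cS * cT) * u \<nu> z1" unfolding z2_def using S[OF z1(2)] u_T[OF z1(1)] by simp
  also have "u \<nu> z1 = (cS * cT) * u \<nu> z" unfolding z1_def using S[OF zU] u_T[OF z(1)] by simp
  finally have "(cS * cT) ^ 3 = 1" using z(2) by (simp add: power3_eq_cube mult.assoc)
  then have "((cS * cT) ^ 3) ^ 2 = 1" by simp
  then have "cS ^ 6 * cT ^ 6 = 1" by (simp add: power_mult_distrib flip: power_mult)
  then show "cT ^ 6 = 1" using c6 by simp
qed

text \<open>Six factors \<open>u\<close> cancel the multipliers \<open>cS\<close>, \<open>cT\<close>, and the \<open>N\<close>-th power of the discriminant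
  compensates a possible pole at the cusp.\<close>
definition G :: "nat \<Rightarrow> ('n \<Rightarrow> nat) \<Rightarrow> complex \<Rightarrow> complex" where
  "G N e z = u e z * u \<nu> z ^ 5 * exp (of_nat (12 * N) * ln_eta2 z)"

lemma G_holomorphic: "G N e holomorphic_on UHP"
  unfolding G_def[abs_def] by (intro holomorphic_intros u_holomorphic ln_eta2_holomorphic)

lemma G_T:
  assumes "z \<in> UHP"
  shows "G N e (z + 1) = G N e z"
proof -
  have "exp (of_nat (12 * N) * (ln_eta2 z + 2 * of_real pi * \<i> / 12)) =
      exp (of_nat (12 * N) * ln_eta2 z) * exp (2 * of_nat N * of_real pi * \<i>)"
    unfolding exp_add[symmetric] by (rule arg_cong[where f = exp]) (simp add: algebra_simps)
  also have "exp (2 * of_nat N * of_real pi * \<i>) = 1"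
    using exp_integer_2pi[of "of_nat N"] by simp
  finally have "exp (of_nat (12 * N) * ln_eta2 (z + 1)) = exp (of_nat (12 * N) * ln_eta2 z)"
    unfolding ln_eta2_T by simp
  moreover have "u e (z + 1) * u \<nu> (z + 1) ^ 5 = cT ^ 6 * (u e z * u \<nu> z ^ 5)"
    unfolding u_T[OF assms] by (simp add: power_mult_distrib eval_nat_numeral mult_ac)
  ultimately show ?thesis unfolding G_def using cS_cT_pow_6 by simp
qed

lemma G_S:
  assumes z: "z \<in> UHP" and e: "2 * (\<Sum>j\<in>UNIV. e j) = n * (n - 1) + 2 * i"
  shows "G N e (- 1 / z) = z ^ (12 * N + 2 * i) * G N e z"
proof -
  \<comment> \<open>The constant -i pi / 2, taken 12 N times, is 2 pi i (-3 N), a period of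
    exp.\<close>
  have "exp (of_nat (12 * N) * (ln_eta2 z + Ln z - \<i> * of_real pi / 2)) =
      exp (of_nat (12 * N) * ln_eta2 z) * exp (of_nat (12 * N) * Ln z) *
      exp (2 * of_int (- 3 * int N) * of_real pi * \<i>)"
    unfolding exp_add[symmetric] by (rule arg_cong[where f = exp]) (simp add: algebra_simps)
  also have "exp (2 * of_int (- 3 * int N) * of_real pi * \<i>) = 1"
    using exp_integer_2pi[of "of_int (- 3 * int N)"] by simp
  also have "exp (of_nat (12 * N) * Ln z) = z ^ (12 * N)"
    unfolding exp_of_nat_mult using UHP_nonzero[OF z] by simp
  finally have "exp (of_nat (12 * N) * ln_eta2 (- 1 / z)) = exp (of_nat (12 * N) * ln_eta2 z) * z ^ (12 * N)"
    unfolding ln_eta2_S[OF z] by simp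
  moreover have "u e (- 1 / z) * u \<nu> (- 1 / z) ^ 5 = cS ^ 6 * z ^ (2 * i) * (u e z * u \<nu> z ^ 5)"
    unfolding u_S[OF z e] u_S[OF z sum_\<nu>_eq]
    by (simp add: power_mult_distrib eval_nat_numeral mult_ac)
  ultimately show ?thesis unfolding G_def using cS_cT_pow_6 by (simp add: power_add mult_ac)
qed

text \<open>Each of the six factors \<open>u\<close> contributes the exponent \<open>defect\<close>,
  and the N-th power of the discriminant contributes N.\<close>

lemma tendsto_G_normalized:
  "((\<lambda>z. qpow (- (6 * defect + real N)) z * G N e z) \<longlongrightarrow> lead e * lead \<nu> ^ 5) at_cusp"
proof -
  have "((\<lambda>z. (qpow (- defect) z * u e z) * (qpow (- defect) z * u \<nu> z) ^ 5 *
      (exp (of_real (real (12 * N)) * ln_eta2 z) * qpow (- real (12 * N) / 12) z))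
      \<longlongrightarrow> lead e * lead \<nu> ^ 5 * 1) at_cusp"
    by (intro tendsto_mult tendsto_power tendsto_u tendsto_exp_ln_eta2_at_cusp)
  moreover have "(qpow (- defect) z * u e z) * (qpow (- defect) z * u \<nu> z) ^ 5 *
      (exp (of_real (real (12 * N)) * ln_eta2 z) * qpow (- real (12 * N) / 12) z) =
      qpow (- (6 * defect + real N)) z * G N e z" for z
  proof -
    have "qpow (- defect) z * qpow (- defect) z ^ 5 * qpow (- real (12 * N) / 12) z = qpow (- (6 * defect + real N)) z"
      unfolding qpow_def exp_of_nat_mult[symmetric] exp_add[symmetric] power_Suc[symmetric]
      by (rule arg_cong[where f = exp]) (simp add: algebra_simps)
    then show ?thesis unfolding G_def by (simp add: power_mult_distrib mult_ac)
  qed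
  ultimately show ?thesis by simp
qed

lemma tendsto_G_pos:
  assumes "6 * defect + real N > 0"
  shows "(G N e \<longlongrightarrow> 0) at_cusp"
proof -
  have "((\<lambda>z. qpow (6 * defect + real N) z * (qpow (- (6 * defect + real N)) z * G N e z))
      \<longlongrightarrow> 0 * (lead e * lead \<nu> ^ 5)) at_cusp"
    by (intro tendsto_mult tendsto_qpow_at_cusp tendsto_G_normalized assms)
  moreover have "qpow (6 * defect + real N) z * (qpow (- (6 * defect + real N)) z * G N e z) = G N e z" for z
    unfolding qpow_minus by simp
  ultimately show ?thesis by (simp only: mult_zero_left)
qed

lemma tendsto_G_zero:
  assumes "6 * defect + real N = 0"
  shows "(G N e \<longlongrightarrow> lead e * lead \<nu> ^ 5) at_cusp"
  using tendsto_G_normalized[of N e] unfolding assms by simp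

text \<open>The bound on N gives a limit at the cusp and hence a q-expansion; the surplus of the
  column orders gives the weight 2 i beyond 12 N. The constant C serves for signs and
  normalisation.\<close>

lemma G_modular_form:
  assumes N: "6 * defect + real N \<ge> 0" and e: "2 * (\<Sum>j\<in>UNIV. e j) = n * (n - 1) + 2 * i"
  shows "modular_form (12 * N + 2 * i) (\<lambda>z. C * G N e z)"
proof -
  let ?g = "\<lambda>z. C * G N e z"
  have hol: "?g holomorphic_on UHP" by (intro holomorphic_intros G_holomorphic)
  have T: "?g (z + 1) = ?g z" if "z \<in> UHP" for z using G_T[OF that] by simp
  have S: "?g (- 1 / z) = z ^ (12 * N + 2 * i) * ?g z" if "z \<in> UHP" for z
    using G_S[OF that e] by simp
  obtain L where "(G N e \<longlongrightarrow> L) at_cusp"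
    using N tendsto_G_pos tendsto_G_zero by (metis order_le_less)
  then have lim: "(?g \<longlongrightarrow> C * L) at_cusp" by (intro tendsto_intros)
  have "\<exists>c. \<forall>z\<in>UHP. (\<lambda>t. c t * qpow (real t) z) sums ?g z"
    by (rule q_expansion_exists[of ?g, OF hol T lim])
  moreover have "\<forall>A\<in>SL2Z. \<forall>z\<in>UHP. ?g (moeb A z) = jfac A z ^ (12 * N + 2 * i) * ?g z"
    using modular_from_generators[of ?g, OF T S] by simp
  ultimately show ?thesis unfolding modular_form_def using hol by blast
qed

section \<open>The inequality for the exponents and the differential equations\<close>

lemma G_constant:
  assumes "((G 0 \<nu>) \<longlongrightarrow> L) at_cusp" "z \<in> UHP"
  shows "G 0 \<nu> z = L"
  by (rule invariant_holomorphic_constant[OF G_holomorphic _ _ assms])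
    (use G_T G_S[OF _ sum_\<nu>_eq] in simp_all)

lemma G_\<nu>_nonzero: "\<exists>z\<in>UHP. G N \<nu> z \<noteq> 0"
  using u_\<nu>_nonzero by (simp add: G_def)

theorem defect_nonpos: "defect \<le> 0"
proof (rule ccontr)
  assume "\<not> defect \<le> 0"
  then have "(G 0 \<nu> \<longlongrightarrow> 0) at_cusp" by (intro tendsto_G_pos) simp
  from G_constant[OF this] show False using G_\<nu>_nonzero[of 0] by blast
qed

text \<open>Where the Wronskian vanishes, Cramer's rule is extended by analytic continuation.\<close>
lemma cramer_relation:
  assumes z: "z \<in> UHP"
  shows "wr \<nu> z * Diter k n (f i) z = (\<Sum>l\<in>UNIV. wr (\<nu>(l := n)) z * Diter k (\<nu> l) (f i) z)"
proof -
  let ?lhs = "\<lambda>z. wr \<nu> z * Diter k n (f i) z"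
  let ?rhs = "\<lambda>z. \<Sum>l\<in>UNIV. wr (\<nu>(l := n)) z * Diter k (\<nu> l) (f i) z"
  have hl: "?lhs holomorphic_on UHP" and hr: "?rhs holomorphic_on UHP"
    by (intro holomorphic_intros wr_holomorphic Diter_holomorphic hol)+
  define U where "U = {z \<in> UHP. wr \<nu> z \<noteq> 0}"
  have "U = UHP \<inter> wr \<nu> -` (- {0})" unfolding U_def by auto
  then have U: "open U"
    using continuous_open_preimage[OF holomorphic_on_imp_continuous_on[OF wr_holomorphic] open_UHP, of "- {0}"]
    by auto
  have Une: "U \<noteq> {}" using u_\<nu>_nonzero by (auto simp: U_def u_def)
  have US: "U \<subseteq> UHP" by (auto simp: U_def)
  have eq: "?lhs w = ?rhs w" if "w \<in> U" for w
  proof -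
    define A :: "complex^'n^'n" where "A = (\<chi> i j. Diter k (\<nu> j) (f i) w)"
    define b :: "complex^'n" where "b = (\<chi> i. Diter k n (f i) w)"
    have d: "det A \<noteq> 0" using that by (simp add: U_def wr_def A_def)
    define x where "x = (\<chi> l. det (\<chi> i j. if j = l then b $ i else A $ i $ j) / det A)"
    have "A *v x = b" using cramer[OF d] x_def by blast
    moreover have "x $ l = wr (\<nu>(l := n)) w / wr \<nu> w" for l
    proof -
      have "(\<chi> i j. if j = l then b $ i else A $ i $ j) = (\<chi> i j. Diter k ((\<nu>(l := n)) j) (f i) w)"
        by (simp add: vec_eq_iff b_def A_def)
      then show ?thesis unfolding x_def wr_def A_def by simp
    qed
    ultimately have "Diter k n (f i) w = (\<Sum>l\<in>UNIV. Diter k (\<nu> l) (f i) w * (wr (\<nu>(l := n)) w / wr \<nu> w))"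
      by (simp add: vec_eq_iff matrix_vector_mult_def A_def b_def)
    then have "wr \<nu> w * Diter k n (f i) w =
        (\<Sum>l\<in>UNIV. wr \<nu> w * (Diter k (\<nu> l) (f i) w * (wr (\<nu>(l := n)) w / wr \<nu> w)))"
      by (simp add: sum_distrib_left)
    also have "\<dots> = ?rhs w" using that by (intro sum.cong) (auto simp: U_def)
    finally show ?thesis .
  qed
  show ?thesis
    by (rule analytic_continuation_open[OF U open_UHP Une connected_UHP US hl hr eq z])
qed

text \<open>The column of the Wronskian holding the derivatives of order \<open>n - i\<close>, for \<open>0 < i \<le> n\<close>.\<close>
definition col :: "nat \<Rightarrow> 'n" where
  "col i = inv_into UNIV \<nu> (n - i)"

lemma \<nu>_col: "0 < i \<Longrightarrow> i \<le> n \<Longrightarrow> \<nu> (col i) = n - i"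
  unfolding col_def using bij by (intro bij_betw_inv_into_right[OF bij]) auto

text \<open>Cramer's rule brought to one side, hence the minus sign for i > 0, and multiplied by one
  common factor that turns the Wronskian and its minors into forms of level one.\<close>

definition coeffs_MLDE :: "complex \<Rightarrow> nat \<Rightarrow> nat \<Rightarrow> complex \<Rightarrow> complex" where
  "coeffs_MLDE C N i z = (if i = 0 then C * G N \<nu> z else - C * G N (\<nu>(col i := n)) z)"

lemma is_MLDE_coeffs:
  assumes "6 * defect + real N \<ge> 0" "C \<noteq> 0"
  shows "is_MLDE n (12 * N) (coeffs_MLDE C N)"
  unfolding is_MLDE_def
proof (intro conjI allI impI)
  fix i assume i: "i \<le> n"
  show "modular_form (12 * N + 2 * i) (coeffs_MLDE C N i)"
  proof (cases "i = 0")
    case True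
    then show ?thesis
      using G_modular_form[OF assms(1) sum_\<nu>_eq, of C] by (simp add: coeffs_MLDE_def[abs_def])
  next
    case False
    then have "n - \<nu> (col i) = i" using \<nu>_col[of i] i by simp
    then show ?thesis
      using G_modular_form[where e = "\<nu>(col i := n)", OF assms(1) sum_\<nu>_upd_eq[of "col i"], of "- C"] False
      by (simp add: coeffs_MLDE_def[abs_def])
  qed
next
  show "\<exists>z\<in>UHP. coeffs_MLDE C N 0 z \<noteq> 0"
    using G_\<nu>_nonzero[of N] assms(2) by (auto simp: coeffs_MLDE_def)
qed

lemma solves_MLDE_coeffs: "solves_MLDE k n (coeffs_MLDE C N) (f r)"
  unfolding solves_MLDE_def
proof
  fix z assume z: "z \<in> UHP"
  \<comment> \<open>\<open>X\<close> does not depend on the column orders e, so the whole equation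
    is X times \<open>cramer_relation\<close>.\<close>
  define X where "X = C * exp (- of_real wt * ln_eta2 z) * u \<nu> z ^ 5 * exp (of_nat (12 * N) * ln_eta2 z)"
  have G: "C * G N e z = X * wr e z" for e unfolding G_def u_def[of e] X_def by (simp add: mult_ac)
  have "(\<Sum>i\<le>n. coeffs_MLDE C N i z * Diter k (n - i) (f r) z) =
      coeffs_MLDE C N 0 z * Diter k n (f r) z +
      (\<Sum>i\<in>{..n} - {0}. coeffs_MLDE C N i z * Diter k (n - i) (f r) z)"
    by (subst sum.remove[of _ 0]) auto
  also have "(\<Sum>i\<in>{..n} - {0}. coeffs_MLDE C N i z * Diter k (n - i) (f r) z) =
      (\<Sum>l\<in>UNIV. - X * wr (\<nu>(l := n)) z * Diter k (\<nu> l) (f r) z)"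
  proof (rule sum.reindex_bij_witness[where i = "\<lambda>l. n - \<nu> l" and j = col])
    fix i assume i: "i \<in> {..n} - {0}"
    then have c: "\<nu> (col i) = n - i" by (intro \<nu>_col) auto
    show "n - \<nu> (col i) = i" using c i by auto
    show "- X * wr (\<nu>(col i := n)) z * Diter k (\<nu> (col i)) (f r) z = coeffs_MLDE C N i z * Diter k (n - i) (f r) z"
    proof -
      have "coeffs_MLDE C N i z = - (C * G N (\<nu>(col i := n)) z)"
        using i by (simp add: coeffs_MLDE_def)
      then show ?thesis unfolding G c by simp
    qed
  next
    fix l :: 'n
    have "\<nu> (col (n - \<nu> l)) = \<nu> l" using \<nu>_col[of "n - \<nu> l"] \<nu>_less[of l] by simp
    then show "col (n - \<nu> l) = l" using inj_\<nu> by (auto dest: injD)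
    show "n - \<nu> l \<in> {..n} - {0}" using \<nu>_less[of l] by auto
  qed simp
  also have "coeffs_MLDE C N 0 z * Diter k n (f r) z = X * (wr \<nu> z * Diter k n (f r) z)"
    unfolding coeffs_MLDE_def using G by simp
  also have "(\<Sum>l\<in>UNIV. - X * wr (\<nu>(l := n)) z * Diter k (\<nu> l) (f r) z) =
      - X * (\<Sum>l\<in>UNIV. wr (\<nu>(l := n)) z * Diter k (\<nu> l) (f r) z)"
    by (simp only: sum_distrib_left mult.assoc)
  finally show "(\<Sum>i\<le>n. coeffs_MLDE C N i z * Diter k (n - i) (f r) z) = 0"
    unfolding cramer_relation[OF z] by (simp only: mult_minus_left add.right_inverse)
qed

theorem exists_MLDE: "\<exists>l g. is_MLDE n l g \<and> (\<forall>i. solves_MLDE k n g (f i))"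
proof -
  obtain N :: nat where "- 6 * defect \<le> real N" using real_arch_simple by blast
  then have "is_MLDE n (12 * N) (coeffs_MLDE 1 N)" by (intro is_MLDE_coeffs) auto
  then show ?thesis using solves_MLDE_coeffs by blast
qed

text \<open>With N = 0 the leading coefficient is the sixth power of \<open>u \<nu>\<close>, up to
  scaling, which is a constant L \<noteq> 0. Multiplying a minor by \<open>u \<nu> ^ 5 / L\<close>
  is then the same as dividing it by \<open>u \<nu>\<close>.\<close>

theorem exists_monic_MLDE:
  assumes "defect = 0"
  shows "\<exists>g. is_monic_MLDE n g \<and> (\<forall>i. solves_MLDE k n g (f i))"
proof -
  define L where "L = lead \<nu> * lead \<nu> ^ 5"
  have L: "L \<noteq> 0" using lead_\<nu>_nonzero by (simp add: L_def)
  have "(G 0 \<nu> \<longlongrightarrow> L) at_cusp" unfolding L_def by (rule tendsto_G_zero) (simp add: assms)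
  from G_constant[OF this] L have "coeffs_MLDE (1 / L) 0 0 z = 1" if "z \<in> UHP" for z
    using that by (simp add: coeffs_MLDE_def)
  moreover have "is_MLDE n (12 * 0) (coeffs_MLDE (1 / L) 0)"
    by (rule is_MLDE_coeffs) (use L assms in auto)
  ultimately have "is_monic_MLDE n (coeffs_MLDE (1 / L) 0)" by (simp add: is_monic_MLDE_def)
  then show ?thesis using solves_MLDE_coeffs by blast
qed

text \<open>Taken to the limit at the cusp, the equation becomes a polynomial identity in each
  exponent. That polynomial and the product of the linear factors at the exponents are monic of
  degree n and agree at n distinct points, so they coincide, and their coefficients in degree n - 1
  can be compared.\<close>

theorem monic_MLDE_defect:
  assumes monic: "is_monic_MLDE n g" and sol: "\<And>i. solves_MLDE k n g (f i)"
  shows "defect = 0"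
proof -
  have mf: "modular_form (2 * r) (g r)" if "r \<le> n" for r
    using monic that unfolding is_monic_MLDE_def is_MLDE_def by simp
  have "\<exists>c. (g r \<longlongrightarrow> c) at_cusp" if r: "r \<le> n" for r
  proof -
    obtain c where "\<And>z. z \<in> UHP \<Longrightarrow> (\<lambda>t. c t * qpow (real t) z) sums g r z"
      using mf[OF r] unfolding modular_form_def by blast
    then have "(g r \<longlongrightarrow> c 0) at_cusp" by (intro tendsto_q_series_at_cusp[where m = 1]) auto
    then show ?thesis by blast
  qed
  then obtain c where c: "\<And>r. r \<le> n \<Longrightarrow> (g r \<longlongrightarrow> c r) at_cusp" by metis
  have "(g 0 \<longlongrightarrow> 1) at_cusp"
    using monic unfolding is_monic_MLDE_def by (intro tendsto_at_cusp_cong[OF tendsto_const]) simp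
  then have c0: "c 0 = 1" using tendsto_unique[OF at_cusp_neq_bot c[of 0]] by simp
  have c1: "c 1 = 0" using weight_2_constant_term[OF _ c[of 1]] mf[of 1] n_pos by simp
  define p where "p = (\<Sum>r\<le>n. smult (c r) (indicial k (n - r)))"
  define Q where "Q = (\<Prod>i\<in>UNIV. [:- complex_of_real (lam i), 1:])"
  have root: "poly p (of_real (lam i)) = 0" for i
  proof -
    have "((\<lambda>z. \<Sum>r\<le>n. g r z * (qpow (- lam i) z * Diter k (n - r) (f i) z)) \<longlongrightarrow>
        (\<Sum>r\<le>n. c r * (poly (indicial k (n - r)) (of_real (lam i)) * a0 i))) at_cusp"
      by (intro tendsto_sum tendsto_mult c tendsto_Diter_at_cusp[OF hol leading]) auto
    moreover have "((\<lambda>z. \<Sum>r\<le>n. g r z * (qpow (- lam i) z * Diter k (n - r) (f i) z)) \<longlongrightarrow> 0) at_cusp"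
    proof (rule tendsto_at_cusp_cong[OF tendsto_const])
      fix z assume "z \<in> UHP"
      then have "(\<Sum>r\<le>n. g r z * Diter k (n - r) (f i) z) = 0" using sol unfolding solves_MLDE_def by blast
      then have "qpow (- lam i) z * (\<Sum>r\<le>n. g r z * Diter k (n - r) (f i) z) = 0" by simp
      then show "0 = (\<Sum>r\<le>n. g r z * (qpow (- lam i) z * Diter k (n - r) (f i) z))"
        by (simp add: sum_distrib_left mult_ac)
    qed
    ultimately have "(\<Sum>r\<le>n. c r * (poly (indicial k (n - r)) (of_real (lam i)) * a0 i)) = 0"
      by (rule tendsto_unique[OF at_cusp_neq_bot])
    then have "poly p (of_real (lam i)) * a0 i = 0"
      by (simp add: p_def poly_sum sum_distrib_right mult.assoc)
    then show ?thesis using a0_nonzero[of i] by simp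
  qed
  have degp: "degree p \<le> n"
    unfolding p_def
  proof (intro degree_sum_le)
    fix r
    show "degree (smult (c r) (indicial k (n - r))) \<le> n"
      using degree_smult_le[of "c r" "indicial k (n - r)"] degree_indicial[of k "n - r"] by linarith
  qed simp
  have coeff_p: "coeff p j = (\<Sum>r\<le>n. c r * coeff (indicial k (n - r)) j)" for j
    by (simp add: p_def coeff_sum)
  have "coeff p n = (\<Sum>r\<in>{0}. c r * coeff (indicial k (n - r)) n)"
    unfolding coeff_p by (rule sum.mono_neutral_right) (use coeff_indicial_gt n_pos in auto)
  then have "coeff p n = 1" using c0 coeff_indicial by simp
  moreover have "coeff Q n = 1" unfolding Q_def card_eq[symmetric] by (rule coeff_card_prod_linear) simp
  ultimately have pQ: "p = Q"
  proof (intro poly_eqI_degree_lead_coeff[where A = "range (\<lambda>i. complex_of_real (lam i))" and n = n])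
    show "degree Q \<le> n" unfolding Q_def card_eq[symmetric] by (rule degree_prod_linear) simp
    show "poly p z = poly Q z" if "z \<in> range (\<lambda>i. complex_of_real (lam i))" for z
      using that root by (auto simp: Q_def poly_prod)
  qed (use degp card_lam in auto)
  obtain m where m: "n = Suc m" using n_pos gr0_implies_Suc by blast
  \<comment> \<open>In degree n - 1 only r = 0 and r = 1 can contribute, and \<open>c 1\<close> is
    the constant term of a form of weight 2.\<close>
  have "coeff p m = (\<Sum>r\<in>{0, 1}. c r * coeff (indicial k (n - r)) m)"
    unfolding coeff_p by (rule sum.mono_neutral_right) (use coeff_indicial_gt m in auto)
  then have "coeff p m = - of_real (\<Sum>s<n. (k + 2 * real s) / 12)"
    using c0 c1 coeff_indicial_pred[of k m] by (simp add: m)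
  moreover have "coeff Q m = - (\<Sum>i\<in>UNIV. complex_of_real (lam i))"
    unfolding Q_def by (rule coeff_prod_linear) (use m card_eq in simp_all)
  ultimately have "complex_of_real (\<Sum>s<n. (k + 2 * real s) / 12) = of_real (\<Sum>i\<in>UNIV. lam i)"
    unfolding pQ by simp
  then have "(\<Sum>s<n. (k + 2 * real s) / 12) = (\<Sum>i\<in>UNIV. lam i)" unfolding of_real_eq_iff .
  then show ?thesis using sum_indicial_exponents[of k n] by (simp add: defect_def wt_def)
qed

end

theorem theorem2p4:
  fixes k :: real
    and v :: "int^2^2 \<Rightarrow> complex"
    and R :: "int^2^2 \<Rightarrow> complex^'n^'n"
    and F :: "complex \<Rightarrow> complex^'n"
    and lam :: "'n \<Rightarrow> real"
    and a :: "'n \<Rightarrow> nat \<Rightarrow> complex"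
    and m :: real
  assumes mult: "multiplier_system k v"
    and rep: "representation R"
    and F_in: "weakly_hol_vvmf k v R F"
    and m_pos: "m > 0"
    and a0: "\<forall>i. a i 0 \<noteq> 0"
    and qexp: "\<forall>i. \<forall>z\<in>UHP. summable (\<lambda>t. a i t * qpow (m * real t) z) \<and>
                 F z $ i = qpow (lam i) z * (\<Sum>t. a i t * qpow (m * real t) z)"
    and distinct: "inj lam"
  shows "real CARD('n) * (k + real CARD('n) - 1) \<ge> 12 * (\<Sum>i\<in>UNIV. lam i) \<and>
         (\<exists>l g. is_MLDE CARD('n) l g \<and> (\<forall>i. solves_MLDE k CARD('n) g (\<lambda>z. F z $ i))) \<and>
         (real CARD('n) * (k + real CARD('n) - 1) = 12 * (\<Sum>i\<in>UNIV. lam i) \<longleftrightarrow>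
          (\<exists>g. is_monic_MLDE CARD('n) g \<and> (\<forall>i. solves_MLDE k CARD('n) g (\<lambda>z. F z $ i))))"
proof -
  obtain \<nu> :: "'n \<Rightarrow> nat" where "bij_betw \<nu> UNIV {0..<CARD('n)}"
    using ex_bij_betw_finite_nat[of "UNIV :: 'n set"] by auto
  then have bij: "bij_betw \<nu> UNIV {..<CARD('n)}" by (simp add: atLeast0LessThan)
  have inv: "jfac B z powr (- of_real k) * F (moeb B z) $ i = v B * (\<Sum>j\<in>UNIV. R B $ i $ j * F z $ j)"
    if "B \<in> SL2Z" "z \<in> UHP" for B z i
  proof -
    have "vslash k B F z = v B *s (R B *v F z)"
      using F_in that unfolding weakly_hol_vvmf_def by blast
    then have "vslash k B F z $ i = (v B *s (R B *v F z)) $ i" by simp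
    then show ?thesis by (simp add: vslash_def slash_def matrix_vector_mult_def)
  qed
  \<comment> \<open>The scalars v(S) and v(T) are absorbed into the representation matrices, which
    leaves linear relations between the components.\<close>
  interpret vector_valued_form k "\<lambda>i z. F z $ i"
    "\<chi> i j. v matS * R matS $ i $ j" "\<chi> i j. v matT * R matT $ i $ j" lam "\<lambda>i. a i 0"
    "CARD('n)" \<nu>
  proof
    fix i :: 'n
    show "(\<lambda>z. F z $ i) holomorphic_on UHP" using F_in by (simp add: weakly_hol_vvmf_def)
    show "a i 0 \<noteq> 0" using a0 by blast
    show "((\<lambda>z. qpow (- lam i) z * F z $ i) \<longlongrightarrow> a i 0) at_cusp"
    proof (rule tendsto_q_series_at_cusp[OF m_pos])
      fix z assume z: "z \<in> UHP"
      have "qpow (- lam i) z * F z $ i = (\<Sum>t. a i t * qpow (m * real t) z)"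
        using qexp z by (simp add: qpow_minus)
      moreover have "summable (\<lambda>t. a i t * qpow (m * real t) z)" using qexp z by blast
      ultimately show "(\<lambda>t. a i t * qpow (m * real t) z) sums (qpow (- lam i) z * F z $ i)"
        by (simp only: summable_sums)
    qed
    fix z assume z: "z \<in> UHP"
    show "F (z + 1) $ i = (\<Sum>j\<in>UNIV. (\<chi> i j. v matT * R matT $ i $ j) $ i $ j * F z $ j)"
      using inv[OF matT(1) z, of i] unfolding matT by (simp add: sum_distrib_left mult.assoc)
    \<comment> \<open>The slash action carries z^(-k); inserting z^k z^(-k) = 1 moves it to the
      other side of the transformation law.\<close>
    have "F (- 1 / z) $ i = z powr of_real k * (z powr (- of_real k) * F (- 1 / z) $ i)"
      using UHP_nonzero[OF z] by (simp add: powr_minus)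
    also have "\<dots> = z powr of_real k * (v matS * (\<Sum>j\<in>UNIV. R matS $ i $ j * F z $ j))"
      using inv[OF matS(1) z, of i] unfolding matS by simp
    finally show "F (- 1 / z) $ i =
        z powr of_real k * (\<Sum>j\<in>UNIV. (\<chi> i j. v matS * R matS $ i $ j) $ i $ j * F z $ j)"
      by (simp add: sum_distrib_left mult.assoc)
  qed (use distinct bij in auto)
  have "real CARD('n) * (k + real CARD('n) - 1) = 12 * (\<Sum>i\<in>UNIV. lam i) \<longleftrightarrow> defect = 0"
    by (auto simp: defect_def wt_def)
  moreover have "12 * (\<Sum>i\<in>UNIV. lam i) \<le> real CARD('n) * (k + real CARD('n) - 1)"
    using defect_nonpos by (simp add: defect_def wt_def)
  ultimately show ?thesis
    using exists_MLDE exists_monic_MLDE monic_MLDE_defect by metis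
qed

end
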